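(* A formula $\varphi$ of $\mathrm{SL}( *,\mathrm{alloc})$ is valid if and only if $\vdash_{\mathsf{C}( * )}\varphi$.
   Context: Let $\mathrm{PVAR}$ be a countably infinite set of program variables and $\mathrm{LOC}$ a countably infinite set of locations. A memory state is a pair $(s,h)$ with $s:\mathrm{PVAR}\to\mathrm{LOC}$ and $h:\mathrm{LOC}\to\mathrm{LOC}$ a partial function with finite domain $\mathrm{dom}(h)$; disjoint heaps $h_1,h_2$ (disjoint domains) have union $h_1+h_2$. The logic $\mathrm{SL}( *,\mathrm{alloc})$ has formulae $\varphi ::= x=y \mid x\hookrightarrow y \mid \mathrm{emp}\mid\mathrm{alloc}(x) \mid \neg\varphi \mid \varphi\wedge\varphi \mid \varphi*\varphi$ with semantics: $x=y$ iff $s(x)=s(y)$; $x\hookrightarrow y$ iff $s(x)\in\mathrm{dom}(h)$ and $h(s(x))=s(y)$; $\mathrm{emp}$ iff $\mathrm{dom}(h)=\emptyset$; $\mathrm{alloc}(x)$ iff $s(x)\in\mathrm{dom}(h)$; Boolean connectives as usual; $\varphi_1*\varphi_2$ iff $h=h_1+h_2$ for disjoint $h_1,h_2$ with $(s,h_i)\models\varphi_i$. Valid means satisfied by all memory states. Abbreviations: $\bot:=\neg(x=x)$, $\top:=\neg\bot$, $x\neq y:=\neg(x=y)$, $\vee,\Rightarrow,\Leftrightarrow$ as usual, $\mathrm{size}\geq0:=\top$, $\mathrm{size}\geq1:=\neg\mathrm{emp}$, $\mathrm{size}\geq\beta+2:=\neg\mathrm{emp}*\mathrm{size}\geq\beta+1$,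 $\mathrm{size}=\beta:=\mathrm{size}\geq\beta\wedge\neg\mathrm{size}\geq\beta+1$, $a\dot{-}b=\max(a-b,0)$. The Hilbert system $\mathsf{C}( * )$ (metavariables $\varphi,\psi,\chi$ over formulae, $x,y,z$ over variables, $\beta_1,\beta_2$ over naturals; $\varphi[y\leftarrow x]$ replaces every $y$ by $x$) has: all propositional tautologies and modus ponens; axioms $x=x$; $\varphi\wedge x=y\Rightarrow\varphi[y\leftarrow x]$; $x\hookrightarrow y\Rightarrow\mathrm{alloc}(x)$; $x\hookrightarrow y\wedge x\hookrightarrow z\Rightarrow y=z$; $(\varphi*\psi)\Leftrightarrow(\psi*\varphi)$; $(\varphi*\psi)*\chi\Leftrightarrow\varphi*(\psi*\chi)$; $(\varphi\vee\psi)*\chi\Rightarrow(\varphi*\chi)\vee(\psi*\chi)$; $(\bot*\varphi)\Leftrightarrow\bot$; $\varphi\Leftrightarrow\varphi*\mathrm{emp}$; $\mathrm{alloc}(x)*\top\Rightarrow\mathrm{alloc}(x)$; $(\mathrm{alloc}(x)*\mathrm{alloc}(x))\Leftrightarrow\bot$; $\lambda*\top\Rightarrow\lambda$ for $\lambda$ one of $\neg\mathrm{emp}$, $x=y$, $x\neq y$, $x\hookrightarrow y$; $\neg\mathrm{alloc}(x)*\neg\mathrm{alloc}(x)\Rightarrow\neg\mathrm{alloc}(x)$; $(\mathrm{alloc}(x)\wedge\neg x\hookrightarrow y)*\top\Rightarrow\neg x\hookrightarrow y$; $\mathrm{alloc}(x)\Rightarrow(\mathrm{alloc}(x)\wedge\mathrm{size}=1)*\top$;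 $\neg\mathrm{emp}\Rightarrow(\mathrm{size}=1)*\top$; $\neg\mathrm{size}\geq\beta_1*\neg\mathrm{size}\geq\beta_2\Rightarrow\neg\mathrm{size}\geq\beta_1+\beta_2\dot{-}1$; $\mathrm{alloc}(x)\wedge\mathrm{alloc}(y)\wedge x\neq y\Rightarrow\mathrm{size}\geq2$; and the rule: from $\varphi\Rightarrow\chi$ infer $\varphi*\psi\Rightarrow\chi*\psi$. *)

theory Defs
  imports "HOL-Library.Countable" "HOL-Library.Infinite_Typeclass"
begin

(* PVAR and LOC are the types 'v and 'l; their being countably infinite is imposed by the sort
   {countable, infinite} where it matters. *)

datatype 'v fm =
    Eq 'v 'v
  | Pto 'v 'v
  | Emp
  | Alloc 'v
  | Neg "'v fm"
  | And "'v fm" "'v fm"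
  | Star "'v fm" "'v fm"

type_synonym ('v, 'l) store = "'v \<Rightarrow> 'l"

(* Finiteness of the domain is required in the definition of validity; it is inherited by the
   subheaps h1 and h2 in the clause for Star. *)
type_synonym 'l heap = "'l \<rightharpoonup> 'l"

primrec sat :: "('v, 'l) store \<Rightarrow> 'l heap \<Rightarrow> 'v fm \<Rightarrow> bool" where
  "sat s h (Eq x y) \<longleftrightarrow> s x = s y"
| "sat s h (Pto x y) \<longleftrightarrow> h (s x) = Some (s y)"
| "sat s h Emp \<longleftrightarrow> dom h = {}"
| "sat s h (Alloc x) \<longleftrightarrow> s x \<in> dom h"
| "sat s h (Neg \<phi>) \<longleftrightarrow> \<not> sat s h \<phi>"
| "sat s h (And \<phi> \<psi>) \<longleftrightarrow> sat s h \<phi> \<and> sat s h \<psi>"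
| "sat s h (Star \<phi> \<psi>) \<longleftrightarrow>
     (\<exists>h1 h2. dom h1 \<inter> dom h2 = {} \<and> h = h1 ++ h2 \<and> sat s h1 \<phi> \<and> sat s h2 \<psi>)"

(* The type argument fixes the locations, which do not occur in the type of formulae. *)
definition valid :: "'l itself \<Rightarrow> 'v fm \<Rightarrow> bool" where
  "valid (_ :: 'l itself) \<phi> \<longleftrightarrow>
     (\<forall>(s :: ('v, 'l) store) (h :: 'l heap). finite (dom h) \<longrightarrow> sat s h \<phi>)"

(* An unspecified but fixed program variable, used to write down the constant Bot. *)
definition some_var :: 'v where
  "some_var = (SOME x. True)"

abbreviation Bot :: "'v fm" where "Bot \<equiv> Neg (Eq some_var some_var)"
abbreviation Top :: "'v fm" where "Top \<equiv> Neg Bot"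
abbreviation Or :: "'v fm \<Rightarrow> 'v fm \<Rightarrow> 'v fm" where "Or \<phi> \<psi> \<equiv> Neg (And (Neg \<phi>) (Neg \<psi>))"
abbreviation Imp :: "'v fm \<Rightarrow> 'v fm \<Rightarrow> 'v fm" where "Imp \<phi> \<psi> \<equiv> Or (Neg \<phi>) \<psi>"
abbreviation Iff :: "'v fm \<Rightarrow> 'v fm \<Rightarrow> 'v fm" where "Iff \<phi> \<psi> \<equiv> And (Imp \<phi> \<psi>) (Imp \<psi> \<phi>)"

fun size_ge :: "nat \<Rightarrow> 'v fm" where
  "size_ge 0 = Top"
| "size_ge (Suc 0) = Neg Emp"
| "size_ge (Suc (Suc \<beta>)) = Star (Neg Emp) (size_ge (Suc \<beta>))"

definition size_eq :: "nat \<Rightarrow> 'v fm" where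
  "size_eq \<beta> = And (size_ge \<beta>) (Neg (size_ge (\<beta> + 1)))"

(* subst y x \<phi> is \<phi>[y \<leftarrow> x]: every occurrence of y is replaced by x. *)
definition subst :: "'v \<Rightarrow> 'v \<Rightarrow> 'v fm \<Rightarrow> 'v fm" where
  "subst y x = map_fm (\<lambda>z. if z = y then x else z)"

(* Propositional tautologies over SL formulae: every formula whose main connective is neither
   Neg nor And, in particular every separating conjunction, is treated as an atom. *)
fun prop_eval :: "('v fm \<Rightarrow> bool) \<Rightarrow> 'v fm \<Rightarrow> bool" where
  "prop_eval v (Neg \<phi>) \<longleftrightarrow> \<not> prop_eval v \<phi>"
| "prop_eval v (And \<phi> \<psi>) \<longleftrightarrow> prop_eval v \<phi> \<and> prop_eval v \<psi>"
| "prop_eval v \<phi> \<longleftrightarrow> v \<phi>"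

definition tautology :: "'v fm \<Rightarrow> bool" where
  "tautology \<phi> \<longleftrightarrow> (\<forall>v. prop_eval v \<phi>)"

inductive provable :: "'v fm \<Rightarrow> bool" ("\<turnstile> _" [50] 50) where
  taut: "tautology \<phi> \<Longrightarrow> \<turnstile> \<phi>"
| mp: "\<turnstile> \<phi> \<Longrightarrow> \<turnstile> Imp \<phi> \<psi> \<Longrightarrow> \<turnstile> \<psi>"
| eq_refl: "\<turnstile> Eq x x"
| eq_subst: "\<turnstile> Imp (And \<phi> (Eq x y)) (subst y x \<phi>)"
| pto_alloc: "\<turnstile> Imp (Pto x y) (Alloc x)"
| pto_fun: "\<turnstile> Imp (And (Pto x y) (Pto x z)) (Eq y z)"
| star_comm: "\<turnstile> Iff (Star \<phi> \<psi>) (Star \<psi> \<phi>)"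
| star_assoc: "\<turnstile> Iff (Star (Star \<phi> \<psi>) \<chi>) (Star \<phi> (Star \<psi> \<chi>))"
| star_or: "\<turnstile> Imp (Star (Or \<phi> \<psi>) \<chi>) (Or (Star \<phi> \<chi>) (Star \<psi> \<chi>))"
| star_bot: "\<turnstile> Iff (Star Bot \<phi>) Bot"
| star_emp: "\<turnstile> Iff \<phi> (Star \<phi> Emp)"
| alloc_mono: "\<turnstile> Imp (Star (Alloc x) Top) (Alloc x)"
| alloc_disj: "\<turnstile> Iff (Star (Alloc x) (Alloc x)) Bot"
| nemp_mono: "\<turnstile> Imp (Star (Neg Emp) Top) (Neg Emp)"
| eq_mono: "\<turnstile> Imp (Star (Eq x y) Top) (Eq x y)"
| neq_mono: "\<turnstile> Imp (Star (Neg (Eq x y)) Top) (Neg (Eq x y))"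
| pto_mono: "\<turnstile> Imp (Star (Pto x y) Top) (Pto x y)"
| nalloc_star: "\<turnstile> Imp (Star (Neg (Alloc x)) (Neg (Alloc x))) (Neg (Alloc x))"
| npto_star: "\<turnstile> Imp (Star (And (Alloc x) (Neg (Pto x y))) Top) (Neg (Pto x y))"
| alloc_size1: "\<turnstile> Imp (Alloc x) (Star (And (Alloc x) (size_eq 1)) Top)"
| nemp_size1: "\<turnstile> Imp (Neg Emp) (Star (size_eq 1) Top)"
| nsize_star:
    "\<turnstile> Imp (Star (Neg (size_ge \<beta>\<^sub>1)) (Neg (size_ge \<beta>\<^sub>2))) (Neg (size_ge (\<beta>\<^sub>1 + \<beta>\<^sub>2 - 1)))"
| alloc_size2: "\<turnstile> Imp (And (And (Alloc x) (Alloc y)) (Neg (Eq x y))) (size_ge 2)"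
| star_intro: "\<turnstile> Imp \<phi> \<chi> \<Longrightarrow> \<turnstile> Imp (Star \<phi> \<psi>) (Star \<chi> \<psi>)"

end

theory Submission
  imports Defs
begin

text \<open>
  Completeness is proved with a canonical model. A world is a maximal consistent set of formulae,
  and a ternary relation on worlds interprets the separating conjunction; the axioms make this
  relation behave like the splitting of heaps, with additive sizes and with allocation distributed
  over the two parts. A world is compared with a memory state by agreement on the atoms over a finite
  set \<open>X\<close> of variables and on the sizes up to a bound \<open>B \<ge> card X\<close>. Agreement up to
  \<open>B1 + B2\<close> is a back-and-forth condition: each splitting on one side is matched by a splitting
  on the other whose parts agree up to \<open>B1\<close> and \<open>B2\<close>. Hence an agreeing world and memory state
  satisfy the same formulae of bounded size, and since each world agrees with some memory state,
  a consistent formula is satisfiable.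
\<close>

section \<open>Soundness\<close>

text \<open>A splitting is determined by the domain of its first part, so a subset \<open>D\<close>
  can stand for a pair of heaps; witnesses and cardinality arguments become statements about sets of
  locations.\<close>

lemma sat_Star_iff:
  "sat s h (Star \<phi> \<psi>) \<longleftrightarrow> (\<exists>D\<subseteq>dom h. sat s (h |` D) \<phi> \<and> sat s (h |` (dom h - D)) \<psi>)"
proof
  assume "sat s h (Star \<phi> \<psi>)"
  then obtain h1 h2 where d: "dom h1 \<inter> dom h2 = {}" and h: "h = h1 ++ h2"
    and s: "sat s h1 \<phi>" "sat s h2 \<psi>" by auto
  have 1: "h |` dom h1 = h1"
    using d unfolding h by (intro ext) (auto simp: restrict_map_def map_add_def split: option.split)
  have "dom h - dom h1 = dom h2" using d h by auto
  then have 2: "h |` (dom h - dom h1) = h2"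
    using d unfolding h by (intro ext) (auto simp: restrict_map_def map_add_def split: option.split)
  show "\<exists>D\<subseteq>dom h. sat s (h |` D) \<phi> \<and> sat s (h |` (dom h - D)) \<psi>"
    using 1 2 s h by (intro exI[of _ "dom h1"]) auto
next
  assume "\<exists>D\<subseteq>dom h. sat s (h |` D) \<phi> \<and> sat s (h |` (dom h - D)) \<psi>"
  then obtain D where D: "D \<subseteq> dom h" "sat s (h |` D) \<phi>" "sat s (h |` (dom h - D)) \<psi>" by auto
  have "h = (h |` D) ++ (h |` (dom h - D))"
    by (intro ext) (auto simp: restrict_map_def map_add_def split: option.split)
  moreover have "dom (h |` D) \<inter> dom (h |` (dom h - D)) = {}" by auto
  ultimately show "sat s h (Star \<phi> \<psi>)"
    using D(2,3) unfolding sat.simps(7) by (intro exI conjI)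
qed

lemma sat_size_ge:
  "finite (dom h) \<Longrightarrow> sat s h (size_ge n) \<longleftrightarrow> n \<le> card (dom h)"
proof (induction n arbitrary: h rule: size_ge.induct)
  case 1
  then show ?case by simp
next
  case 2
  then show ?case by (simp add: Suc_le_eq card_gt_0_iff)
next
  case (3 n)
  have "sat s h (size_ge (Suc (Suc n))) \<longleftrightarrow>
    (\<exists>D\<subseteq>dom h. D \<noteq> {} \<and> Suc n \<le> card (dom h - D))"
    unfolding size_ge.simps sat_Star_iff
  proof (intro ex_cong1 conj_cong refl)
    fix D assume D: "D \<subseteq> dom h"
    show "sat s (h |` D) (Neg Emp) \<longleftrightarrow> D \<noteq> {}" using D by auto
    have "dom (h |` (dom h - D)) = dom h - D" by auto
    then show "sat s (h |` (dom h - D)) (size_ge (Suc n)) \<longleftrightarrow> Suc n \<le> card (dom h - D)"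
      using 3 by simp
  qed
  also have "\<dots> \<longleftrightarrow> Suc (Suc n) \<le> card (dom h)"
  proof
    assume "\<exists>D\<subseteq>dom h. D \<noteq> {} \<and> Suc n \<le> card (dom h - D)"
    then obtain D where D: "D\<subseteq>dom h" "D \<noteq> {}" "Suc n \<le> card (dom h - D)" by blast
    then have "dom h - D \<subset> dom h" by blast
    with 3(2) have "card (dom h - D) < card (dom h)" by (rule psubset_card_mono)
    with D(3) show "Suc (Suc n) \<le> card (dom h)" by linarith
  next
    assume a: "Suc (Suc n) \<le> card (dom h)"
    then have "dom h \<noteq> {}" using card.empty by force
    then obtain l where l: "l \<in> dom h" by blast
    then have "card (dom h - {l}) = card (dom h) - 1" by (rule card_Diff_singleton)
    then show "\<exists>D\<subseteq>dom h. D \<noteq> {} \<and> Suc n \<le> card (dom h - D)"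
      using a l by (intro exI[of _ "{l}"]) simp
  qed
  finally show ?case .
qed

lemma sat_size_eq:
  "finite (dom h) \<Longrightarrow> sat s h (size_eq n) \<longleftrightarrow> card (dom h) = n"
  unfolding size_eq_def by (simp add: sat_size_ge del: size_ge.simps) linarith

text \<open>Serves the substitution axiom: when \<open>s x = s y\<close>, composing the store with
  the renaming gives \<open>s\<close> back.\<close>

lemma sat_map_fm: "sat s h (map_fm f \<phi>) \<longleftrightarrow> sat (s \<circ> f) h \<phi>"
  by (induction \<phi> arbitrary: h) simp_all

text \<open>Satisfaction in a fixed memory state is itself a propositional valuation, which makes
  tautologies sound.\<close>

lemma prop_eval_sat: "prop_eval (sat s h) \<phi> \<longleftrightarrow> sat s h \<phi>"
  by (induction \<phi>) simp_all

lemma sat_StarI: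
  "dom h1 \<inter> dom h2 = {} \<Longrightarrow> sat s h1 \<phi> \<Longrightarrow> sat s h2 \<psi> \<Longrightarrow> sat s (h1 ++ h2) (Star \<phi> \<psi>)"
  unfolding sat.simps(7) by (intro exI[of _ h1] exI[of _ h2] conjI refl)

lemma sat_StarE:
  assumes "sat s h (Star \<phi> \<psi>)"
  obtains h1 h2 where "dom h1 \<inter> dom h2 = {}" "h = h1 ++ h2" "sat s h1 \<phi>" "sat s h2 \<psi>"
  using assms unfolding sat.simps(7) by (elim exE conjE) (rule that)

declare sat.simps(7) [simp del]

lemma sat_Star_commute:
  assumes "sat s h (Star \<phi> \<psi>)" shows "sat s h (Star \<psi> \<phi>)"
  using assms
proof (rule sat_StarE)
  fix h1 h2
  assume *: "dom h1 \<inter> dom h2 = {}" "h = h1 ++ h2" "sat s h1 \<phi>" "sat s h2 \<psi>"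
  then have "sat s (h2 ++ h1) (Star \<psi> \<phi>)" by (intro sat_StarI) auto
  then show ?thesis using * map_add_comm by metis
qed

lemma sat_Star_assoc: "sat s h (Star (Star \<phi> \<psi>) \<chi>) \<longleftrightarrow> sat s h (Star \<phi> (Star \<psi> \<chi>))"
proof
  assume "sat s h (Star (Star \<phi> \<psi>) \<chi>)"
  then obtain h12 h1 h2 h3 where *: "dom h12 \<inter> dom h3 = {}" "h = h12 ++ h3" "sat s h3 \<chi>"
    "dom h1 \<inter> dom h2 = {}" "h12 = h1 ++ h2" "sat s h1 \<phi>" "sat s h2 \<psi>"
    by (elim sat_StarE)
  then have "sat s (h1 ++ (h2 ++ h3)) (Star \<phi> (Star \<psi> \<chi>))"
    by (intro sat_StarI) auto
  then show "sat s h (Star \<phi> (Star \<psi> \<chi>))" using * by simp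
next
  assume "sat s h (Star \<phi> (Star \<psi> \<chi>))"
  then obtain h1 h2 h3 h23 where *: "dom h1 \<inter> dom h23 = {}" "h = h1 ++ h23" "sat s h1 \<phi>"
    "dom h2 \<inter> dom h3 = {}" "h23 = h2 ++ h3" "sat s h2 \<psi>" "sat s h3 \<chi>"
    by (elim sat_StarE)
  then have "sat s ((h1 ++ h2) ++ h3) (Star (Star \<phi> \<psi>) \<chi>)"
    by (intro sat_StarI) auto
  then show "sat s h (Star (Star \<phi> \<psi>) \<chi>)" using * by simp
qed

lemma sat_Star_Emp: "sat s h (Star \<phi> Emp) \<longleftrightarrow> sat s h \<phi>"
proof
  show "sat s h \<phi>" if "sat s h (Star \<phi> Emp)" using that by (rule sat_StarE) simp
  show "sat s h (Star \<phi> Emp)" if "sat s h \<phi>"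
    using sat_StarI[of h Map.empty s \<phi> Emp] that by simp
qed

text \<open>The induction on derivations keeps the heap arbitrary because \<open>star_intro\<close>
  uses its premise at a subheap.\<close>

lemma soundness:
  assumes "\<turnstile> \<phi>" "finite (dom h)"
  shows "sat s h \<phi>"
  using assms
proof (induction arbitrary: h rule: provable.induct)
  case (taut \<phi>)
  then show ?case unfolding tautology_def using prop_eval_sat by blast
next
  case (eq_subst \<phi> x y)
  show ?case
  proof (cases "s x = s y")
    case True
    then have "s \<circ> (\<lambda>z. if z = y then x else z) = s" by auto
    then show ?thesis by (simp add: subst_def sat_map_fm)
  qed simp
next
  case (star_comm \<phi> \<psi>)
  then show ?case using sat_Star_commute by simp blast
next
  case (star_assoc \<phi> \<psi> \<chi>)
  then show ?case using sat_Star_assoc by simp blast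
next
  case (star_emp \<phi>)
  then show ?case by (simp add: sat_Star_Emp)
next
  case (alloc_size1 x)
  show ?case
  proof (cases "s x \<in> dom h")
    case True
    then have "dom (h |` {s x}) = {s x}" by auto
    then have "sat s (h |` {s x}) (And (Alloc x) (size_eq 1))"
      by (simp add: sat_size_eq del: size_ge.simps)
    then have "sat s h (Star (And (Alloc x) (size_eq 1)) Top)"
      using True unfolding sat_Star_iff by (intro exI[of _ "{s x}"]) simp
    then show ?thesis by simp
  qed auto
next
  case nemp_size1
  show ?case
  proof (cases "dom h = {}")
    case False
    then obtain l where l: "l \<in> dom h" by blast
    then have "dom (h |` {l}) = {l}" by auto
    then have "sat s (h |` {l}) (size_eq 1)"
      by (simp add: sat_size_eq del: size_ge.simps)
    then have "sat s h (Star (size_eq 1) Top)"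
      using l unfolding sat_Star_iff by (intro exI[of _ "{l}"]) simp
    then show ?thesis by simp
  qed auto
next
  case (nsize_star b1 b2)
  show ?case
  proof (cases "sat s h (Star (Neg (size_ge b1)) (Neg (size_ge b2)))")
    case True
    then obtain h1 h2 where d: "dom h1 \<inter> dom h2 = {}" and h: "h = h1 ++ h2"
      and 1: "sat s h1 (Neg (size_ge b1))" and 2: "sat s h2 (Neg (size_ge b2))"
      by (rule sat_StarE)
    have fin: "finite (dom h1)" "finite (dom h2)" using nsize_star h by auto
    have "card (dom h) = card (dom h1) + card (dom h2)"
      using card_Un_disjoint[OF fin d] h by (simp add: Un_commute)
    moreover have "card (dom h1) < b1" "card (dom h2) < b2"
      using 1 2 fin by (auto simp: sat_size_ge)
    ultimately have "\<not> sat s h (size_ge (b1 + b2 - 1))"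
      using nsize_star by (simp add: sat_size_ge)
    then show ?thesis by simp
  qed simp
next
  case (alloc_size2 x y)
  { assume a: "s x \<in> dom h" "s y \<in> dom h" "s x \<noteq> s y"
    then have "card {s x, s y} \<le> card (dom h)" using alloc_size2 by (intro card_mono) auto
    then have "2 \<le> card (dom h)" using a by simp }
  then show ?case using sat_size_ge[OF alloc_size2, of s 2] by (auto simp del: size_ge.simps)
next
  case (star_intro \<phi> \<chi> \<psi>)
  have "sat s h (Star \<chi> \<psi>)" if "sat s h (Star \<phi> \<psi>)"
    using that
  proof (rule sat_StarE)
    fix h1 h2
    assume *: "dom h1 \<inter> dom h2 = {}" "h = h1 ++ h2" "sat s h1 \<phi>" "sat s h2 \<psi>"
    then have "sat s h1 (Imp \<phi> \<chi>)" using star_intro by simp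
    then show ?thesis using sat_StarI[OF *(1) _ *(4)] * by simp
  qed
  then show ?case by simp
next
  case (star_or \<phi> \<psi> \<chi>)
  have "sat s h (Star \<phi> \<chi>) \<or> sat s h (Star \<psi> \<chi>)" if "sat s h (Star (Or \<phi> \<psi>) \<chi>)"
    using that by (rule sat_StarE) (auto intro: sat_StarI)
  then show ?case by auto
next
  case nemp_mono
  then show ?case by (auto elim!: sat_StarE)
next
  case (npto_star x y)
  then show ?case by (auto elim!: sat_StarE simp: map_add_Some_iff disjoint_iff domIff)
qed (auto elim!: sat_StarE simp: map_add_def disjoint_iff domIff split: option.splits)

section \<open>Worlds\<close>

text \<open>Supplies the enumeration of all formulae that \<open>Lindenbaum\<close> runs
  through.\<close>

instance fm :: (countable) countable
  by countable_datatype

text \<open>The maximal consistent sets, as predicates. The clause for \<open>Neg\<close> gives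
  consistency and maximality at once; closure under modus ponens follows because \<open>Imp\<close>
  is built from \<open>Neg\<close> and \<open>And\<close>.\<close>

definition world :: "('v fm \<Rightarrow> bool) \<Rightarrow> bool" where
  "world v \<longleftrightarrow> (\<forall>\<phi>. v (Neg \<phi>) \<longleftrightarrow> \<not> v \<phi>) \<and> (\<forall>\<phi> \<psi>. v (And \<phi> \<psi>) \<longleftrightarrow> v \<phi> \<and> v \<psi>) \<and> (\<forall>\<phi>. \<turnstile> \<phi> \<longrightarrow> v \<phi>)"

text \<open>The canonical accessibility relation of \<open>Star\<close> read as a binary
  modality.\<close>

definition splits :: "('v fm \<Rightarrow> bool) \<Rightarrow> ('v fm \<Rightarrow> bool) \<Rightarrow> ('v fm \<Rightarrow> bool) \<Rightarrow> bool" where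
  "splits v1 v2 v \<longleftrightarrow> world v1 \<and> world v2 \<and> world v \<and> (\<forall>\<phi> \<psi>. v1 \<phi> \<longrightarrow> v2 \<psi> \<longrightarrow> v (Star \<phi> \<psi>))"

lemma world_Neg: "world v \<Longrightarrow> v (Neg \<phi>) \<longleftrightarrow> \<not> v \<phi>"
  and world_And: "world v \<Longrightarrow> v (And \<phi> \<psi>) \<longleftrightarrow> v \<phi> \<and> v \<psi>"
  and world_provable: "world v \<Longrightarrow> \<turnstile> \<phi> \<Longrightarrow> v \<phi>"
  unfolding world_def by blast+

lemmas world_simps = world_Neg world_And

lemma world_Imp:
  assumes "world v" "\<turnstile> Imp \<phi> \<psi>" "v \<phi>" shows "v \<psi>"
  using world_provable[OF assms(1,2)] assms(3) by (simp add: world_simps[OF assms(1)])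

lemma world_Iff:
  assumes "world v" "\<turnstile> Iff \<phi> \<psi>" shows "v \<phi> \<longleftrightarrow> v \<psi>"
  using world_provable[OF assms] by (auto simp: world_simps[OF assms(1)])

lemma world_refl: "world v \<Longrightarrow> v (Eq x x)"
  by (rule world_provable[OF _ eq_refl])

section \<open>Derived rules of the calculus\<close>

lemma mp1:
  assumes "tautology (Imp \<phi> \<psi>)" "\<turnstile> \<phi>" shows "\<turnstile> \<psi>"
  by (rule mp[OF assms(2) taut[OF assms(1)]])

lemma mp2:
  assumes "tautology (Imp \<phi> (Imp \<psi> \<chi>))" "\<turnstile> \<phi>" "\<turnstile> \<psi>" shows "\<turnstile> \<chi>"
  by (rule mp[OF assms(3) mp1[OF assms(1,2)]])

lemma Imp_refl: "\<turnstile> Imp a a"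
  and Imp_And1: "\<turnstile> Imp (And a b) a"
  and Imp_And2: "\<turnstile> Imp (And a b) b"
  by (rule taut, simp add: tautology_def)+

lemma Imp_And_mono: "\<turnstile> Imp a a' \<Longrightarrow> \<turnstile> Imp b b' \<Longrightarrow> \<turnstile> Imp (And a b) (And a' b')"
  by (erule (1) mp2[rotated]) (simp add: tautology_def)

lemma Imp_trans: "\<turnstile> Imp a b \<Longrightarrow> \<turnstile> Imp b c \<Longrightarrow> \<turnstile> Imp a c"
  by (erule (1) mp2[rotated]) (simp add: tautology_def)

lemma Iff_Imp: "\<turnstile> Iff a b \<Longrightarrow> \<turnstile> Imp a b"
  by (erule mp1[rotated]) (simp add: tautology_def)

text \<open>\<open>star_intro\<close> acts on the left factor only, so it is applied twice, each
  time followed by an exchange of the factors.\<close>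

lemma Imp_Star_mono:
  assumes "\<turnstile> Imp a a'" "\<turnstile> Imp b b'"
  shows "\<turnstile> Imp (Star a b) (Star a' b')"
proof -
  have "\<turnstile> Imp (Star a b) (Star b a')"
    using star_intro[OF assms(1)] Iff_Imp[OF star_comm] by (rule Imp_trans)
  moreover have "\<turnstile> Imp (Star b a') (Star a' b')"
    using star_intro[OF assms(2)] Iff_Imp[OF star_comm] by (rule Imp_trans)
  ultimately show ?thesis by (rule Imp_trans)
qed

text \<open>Taking for \<open>P\<close> a property of formulae other than consistency yields worlds that stand in a
  prescribed relation to given ones.\<close>

lemma Lindenbaum:
  fixes P :: "'v::countable fm \<Rightarrow> bool"
  assumes mono: "\<And>a b. \<turnstile> Imp a b \<Longrightarrow> P a \<Longrightarrow> P b"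
    and disj: "\<And>a b. P (Or a b) \<Longrightarrow> P a \<or> P b"
    and bot: "\<not> P Bot" and \<phi>: "P \<phi>"
  obtains w where "world w" "w \<phi>" "\<And>\<chi>. w \<chi> \<Longrightarrow> P \<chi>"
proof -
  \<comment> \<open>\<open>\<gamma> n\<close> conjoins \<open>\<phi>\<close> with the decisions on
    the first \<open>n\<close> formulae; a formula is negated only when adding it would lose
    \<open>P\<close>.\<close>
  define \<gamma> where "\<gamma> = rec_nat \<phi> (\<lambda>n g. if P (And g (from_nat n)) then And g (from_nat n)
    else And g (Neg (from_nat n)))"
  have g0: "\<gamma> 0 = \<phi>" and gS: "\<gamma> (Suc n) = (if P (And (\<gamma> n) (from_nat n)) then And (\<gamma> n) (from_nat n)
    else And (\<gamma> n) (Neg (from_nat n)))" for n by (simp_all add: \<gamma>_def)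
  have P\<gamma>: "P (\<gamma> n)" for n
  proof (induction n)
    case (Suc n)
    have "\<turnstile> Imp (\<gamma> n) (Or (And (\<gamma> n) (from_nat n)) (And (\<gamma> n) (Neg (from_nat n))))"
      by (rule taut) (simp add: tautology_def)
    from mono[OF this Suc] have "P (And (\<gamma> n) (from_nat n)) \<or> P (And (\<gamma> n) (Neg (from_nat n)))"
      by (rule disj)
    then show ?case by (auto simp: gS)
  qed (simp add: g0 \<phi>)
  have dec1: "\<turnstile> Imp (\<gamma> (Suc n)) (\<gamma> n)" for n
    by (rule taut) (simp add: tautology_def gS)
  have dec: "\<turnstile> Imp (\<gamma> n) (\<gamma> m)" if "m \<le> n" for m n
    using that
  proof (induction n rule: dec_induct)
    case (step n)
    then show ?case using Imp_trans[OF dec1] by blast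
  qed (rule Imp_refl)
  \<comment> \<open>The deductive closure of the chain; since the chain is decreasing, finitely many
    members of \<open>w\<close> follow from one \<open>\<gamma> n\<close>.\<close>
  define w where "w \<chi> \<longleftrightarrow> (\<exists>n. \<turnstile> Imp (\<gamma> n) \<chi>)" for \<chi>
  have w2: "\<exists>n. \<turnstile> Imp (\<gamma> n) a \<and> \<turnstile> Imp (\<gamma> n) b" if "w a" "w b" for a b
  proof -
    from that obtain n m where "\<turnstile> Imp (\<gamma> n) a" "\<turnstile> Imp (\<gamma> m) b" unfolding w_def by blast
    then have "\<turnstile> Imp (\<gamma> (max n m)) a \<and> \<turnstile> Imp (\<gamma> (max n m)) b"
      using Imp_trans[OF dec[of n "max n m"]] Imp_trans[OF dec[of m "max n m"]] by simp_all
    then show ?thesis by blast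
  qed
  have wP: "P \<chi>" if "w \<chi>" for \<chi> using that mono P\<gamma> unfolding w_def by blast
  have wand: "w (And a b) \<longleftrightarrow> w a \<and> w b" for a b
  proof
    assume "w (And a b)"
    moreover have "\<turnstile> Imp (And a b) a" "\<turnstile> Imp (And a b) b"
      by (rule taut, simp add: tautology_def)+
    ultimately show "w a \<and> w b" unfolding w_def using Imp_trans by blast
  next
    assume "w a \<and> w b"
    then obtain n where "\<turnstile> Imp (\<gamma> n) a" "\<turnstile> Imp (\<gamma> n) b" using w2 by blast
    then have "\<turnstile> Imp (\<gamma> n) (And a b)" by (rule mp2[rotated]) (simp add: tautology_def)
    then show "w (And a b)" unfolding w_def by blast
  qed
  have wneg: "w (Neg a) \<longleftrightarrow> \<not> w a" for a
  proof
    assume 1: "w (Neg a)"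
    show "\<not> w a"
    proof
      assume "w a"
      then obtain n where "\<turnstile> Imp (\<gamma> n) a" "\<turnstile> Imp (\<gamma> n) (Neg a)" using 1 w2 by blast
      then have "\<turnstile> Imp (\<gamma> n) Bot" by (rule mp2[rotated]) (simp add: tautology_def)
      then show False using mono P\<gamma> bot by blast
    qed
  next
    assume "\<not> w a"
    obtain n where n: "a = from_nat n" by (metis from_nat_to_nat)
    have "\<not> P (And (\<gamma> n) a)"
    proof
      assume "P (And (\<gamma> n) a)"
      then have "\<gamma> (Suc n) = And (\<gamma> n) a" using gS n by simp
      then have "\<turnstile> Imp (\<gamma> (Suc n)) a" by (intro taut) (simp add: tautology_def)
      then show False using \<open>\<not> w a\<close> w_def by blast
    qed
    then have "\<gamma> (Suc n) = And (\<gamma> n) (Neg a)" using gS n by simp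
    then have "\<turnstile> Imp (\<gamma> (Suc n)) (Neg a)" by (intro taut) (simp add: tautology_def)
    then show "w (Neg a)" using w_def by blast
  qed
  have wth: "w a" if "\<turnstile> a" for a
    using mp1[of a "Imp (\<gamma> 0) a"] that unfolding w_def by (auto simp: tautology_def)
  have "world w" unfolding world_def using wand wneg wth by blast
  moreover have "w \<phi>" unfolding w_def using Imp_refl g0 by metis
  ultimately show ?thesis using that wP by blast
qed

section \<open>The separating conjunction inside a world\<close>

context
  fixes v :: "'v::countable fm \<Rightarrow> bool"
  assumes v: "world v"
begin

lemma Star_commute: "v (Star a b) \<longleftrightarrow> v (Star b a)"
  using world_Iff[OF v star_comm] .

lemma Star_associate: "v (Star (Star a b) c) \<longleftrightarrow> v (Star a (Star b c))"
  using world_Iff[OF v star_assoc] .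

lemma Star_mono: "\<turnstile> Imp a a' \<Longrightarrow> \<turnstile> Imp b b' \<Longrightarrow> v (Star a b) \<Longrightarrow> v (Star a' b')"
  by (rule world_Imp[OF v Imp_Star_mono])

lemma Star_Or: "v (Star (Or a b) c) \<Longrightarrow> v (Star a c) \<or> v (Star b c)"
  using world_Imp[OF v star_or] by (auto simp: world_simps[OF v])

lemma Star_Or2: "v (Star c (Or a b)) \<Longrightarrow> v (Star c a) \<or> v (Star c b)"
  using Star_Or[of a b c] by (simp only: Star_commute[of c])

lemma Star_Bot: "\<not> v (Star Bot a)"
proof -
  have "\<not> v Bot" using world_refl[OF v] world_Neg[OF v] by blast
  then show ?thesis using world_Iff[OF v star_bot] by blast
qed

lemma Star_Bot2: "\<not> v (Star a Bot)"
  using Star_commute[of a Bot] Star_Bot[of a] by blast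

end

text \<open>\<open>Lindenbaum\<close> is applied to the property \<open>P\<close> of fitting next to
  every formula of \<open>v1\<close>; a world all of whose members have \<open>P\<close> is a second
  part.\<close>

lemma splits_extend:
  fixes v :: "'v::countable fm \<Rightarrow> bool"
  assumes v: "world v" and v1: "world v1" and \<psi>: "\<And>\<chi>. v1 \<chi> \<Longrightarrow> v (Star \<chi> \<psi>)"
  obtains v2 where "splits v1 v2 v" "v2 \<psi>"
proof -
  define P where "P \<xi> \<longleftrightarrow> (\<forall>\<chi>. v1 \<chi> \<longrightarrow> v (Star \<chi> \<xi>))" for \<xi>
  have disj: "P a \<or> P b" if P: "P (Or a b)" for a b
  proof (rule ccontr)
    assume "\<not> (P a \<or> P b)"
    then obtain c d where cd: "v1 c" "\<not> v (Star c a)" "v1 d" "\<not> v (Star d b)"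
      unfolding P_def by blast
    \<comment> \<open>\<open>v1\<close> is closed under conjunction, so the two counterexamples
      merge into one that defeats both disjuncts.\<close>
    then have "v (Star (And c d) (Or a b))" using P unfolding P_def by (simp add: world_simps[OF v1])
    then have "v (Star (And c d) a) \<or> v (Star (And c d) b)" by (rule Star_Or2[OF v])
    then show False
      using cd(2,4) Star_mono[OF v Imp_And1 Imp_refl] Star_mono[OF v Imp_And2 Imp_refl] by blast
  qed
  obtain v2 where "world v2" "v2 \<psi>" "\<And>\<chi>. v2 \<chi> \<Longrightarrow> P \<chi>"
  proof (rule Lindenbaum[of P \<psi>])
    show "P b" if "\<turnstile> Imp a b" "P a" for a b
      using that Star_mono[OF v Imp_refl] unfolding P_def by blast
    show "\<not> P Bot" using Star_Bot2[OF v] world_refl[OF v1] unfolding P_def by blast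
    show "P \<psi>" using \<psi> P_def by blast
  qed (use disj in auto)
  then show ?thesis using that v v1 unfolding splits_def P_def by blast
qed

text \<open>The existence lemma of the canonical model: \<open>v1\<close> is chosen first, against
  the single formula \<open>\<psi>\<close>, and then \<open>v2\<close> against all of
  \<open>v1\<close>.\<close>

lemma splits_exist:
  fixes v :: "'v::countable fm \<Rightarrow> bool"
  assumes v: "world v" and "v (Star \<phi> \<psi>)"
  obtains v1 v2 where "splits v1 v2 v" "v1 \<phi>" "v2 \<psi>"
proof -
  obtain v1 where v1: "world v1" "v1 \<phi>" "\<And>\<chi>. v1 \<chi> \<Longrightarrow> v (Star \<chi> \<psi>)"
  proof (rule Lindenbaum[of "\<lambda>\<chi>. v (Star \<chi> \<psi>)" \<phi>])
    show "v (Star b \<psi>)" if "\<turnstile> Imp a b" "v (Star a \<psi>)" for a b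
      using that Star_mono[OF v _ Imp_refl] by blast
    show "\<not> v (Star Bot \<psi>)" using Star_Bot[OF v] .
  qed (use assms Star_Or[OF v] in auto)
  then show ?thesis using splits_extend[OF v v1(1,3)] that by blast
qed

lemma splits_Star: "splits v1 v2 v \<Longrightarrow> v1 \<phi> \<Longrightarrow> v2 \<psi> \<Longrightarrow> v (Star \<phi> \<psi>)"
  by (auto simp: splits_def)

lemma splits_world:
  assumes "splits v1 v2 v" shows "world v1" "world v2" "world v"
  using assms by (auto simp: splits_def)

lemma splits_commute:
  fixes v :: "'v::countable fm \<Rightarrow> bool"
  assumes "splits v1 v2 v" shows "splits v2 v1 v"
  unfolding splits_def
proof (intro conjI allI impI)
  fix \<phi> \<psi> assume "v2 \<phi>" "v1 \<psi>"
  then show "v (Star \<phi> \<psi>)"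
    using splits_Star[OF assms] Star_commute[OF splits_world(3)[OF assms], of \<phi>] by simp
qed (rule splits_world[OF assms])+

text \<open>By \<open>star_emp\<close>, \<open>v\<close> can serve as one of its own parts, next to
  a world that stands for the empty heap.\<close>

lemma splits_Emp:
  fixes v :: "'v::countable fm \<Rightarrow> bool"
  assumes "world v"
  obtains e where "splits e v v" "e Emp"
proof (rule splits_extend[OF assms assms, of Emp])
  show "v (Star \<chi> Emp)" if "v \<chi>" for \<chi> using that world_Iff[OF assms star_emp] by blast
qed (blast intro: that splits_commute)

text \<open>The world \<open>v23\<close> must fit next to \<open>v1\<close> and also contain
  \<open>Star b c\<close> for all \<open>b\<close> in \<open>v2\<close> and \<open>c\<close> in
  \<open>v3\<close>. Building \<open>Star b c\<close> into \<open>P\<close> secures both.\<close>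

lemma splits_assoc:
  fixes v :: "'v::countable fm \<Rightarrow> bool"
  assumes v: "splits v12 v3 v" and v12: "splits v1 v2 v12"
  obtains v23 where "splits v2 v3 v23" "splits v1 v23 v"
proof -
  note W = splits_world[OF v] splits_world[OF v12]
  define P where "P \<xi> \<longleftrightarrow> (\<forall>a b c. v1 a \<longrightarrow> v2 b \<longrightarrow> v3 c \<longrightarrow> v (Star a (And \<xi> (Star b c))))" for \<xi>
  have disj: "P x \<or> P y" if P: "P (Or x y)" for x y
  proof (rule ccontr)
    assume "\<not> (P x \<or> P y)"
    then obtain a b c a' b' c' where *: "v1 a" "v2 b" "v3 c" "\<not> v (Star a (And x (Star b c)))"
       "v1 a'" "v2 b'" "v3 c'" "\<not> v (Star a' (And y (Star b' c')))" unfolding P_def by blast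
    \<comment> \<open>The two triples of counterexamples are merged componentwise, so that one
      formula defeats both disjuncts.\<close>
    let ?S = "Star (And b b') (And c c')"
    have "v (Star (And a a') (And (Or x y) ?S))"
      using P * unfolding P_def
      by (simp add: world_simps[OF W(1)] world_simps[OF W(2)] world_simps[OF W(4)] world_simps[OF W(5)])
    then have "v (Star (And a a') (Or (And x ?S) (And y ?S)))"
      by (rule Star_mono[OF W(3) Imp_refl, rotated]) (rule taut, auto simp: tautology_def)
    then have "v (Star (And a a') (And x ?S)) \<or> v (Star (And a a') (And y ?S))"
      using Star_Or2[OF W(3)] by blast
    moreover have "v (Star a (And x (Star b c)))" if "v (Star (And a a') (And x ?S))"
      using that by (rule Star_mono[OF W(3) Imp_And1, rotated])
        (intro Imp_And_mono Imp_refl Imp_Star_mono Imp_And1)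
    moreover have "v (Star a' (And y (Star b' c')))" if "v (Star (And a a') (And y ?S))"
      using that by (rule Star_mono[OF W(3) Imp_And2, rotated])
        (intro Imp_And_mono Imp_refl Imp_Star_mono Imp_And2)
    ultimately show False using * by blast
  qed
  have Star_And: "v (Star a d)" if "v (Star a (And d e))" for a d e
    using that Star_mono[OF W(3) Imp_refl Imp_And1] by blast
  obtain v23 where v23: "world v23" "\<And>\<chi>. v23 \<chi> \<Longrightarrow> P \<chi>"
  proof (rule Lindenbaum[of P Top])
    show "P b" if "\<turnstile> Imp a b" "P a" for a b
      using that Star_mono[OF W(3) Imp_refl Imp_And_mono[OF _ Imp_refl]] unfolding P_def by blast
    show "\<not> P Bot"
      using Star_And[of _ Bot] Star_Bot2[OF W(3)] world_refl[OF W(2)] world_refl[OF W(4)] world_refl[OF W(5)]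
      unfolding P_def by blast
    \<comment> \<open>For \<open>Top\<close> the property \<open>P\<close> is just the associativity
      axiom read in \<open>v\<close>.\<close>
    show "P Top" unfolding P_def
    proof (intro allI impI)
      fix a b c assume "v1 a" "v2 b" "v3 c"
      then have "v (Star a (Star b c))"
        using splits_Star[OF v splits_Star[OF v12]] Star_associate[OF W(3)] by simp
      then show "v (Star a (And Top (Star b c)))"
        by (rule Star_mono[OF W(3) Imp_refl, rotated]) (rule mp1[OF _ eq_refl[of some_var]], simp add: tautology_def)
    qed
  qed (use disj in auto)
  have "splits v1 v23 v" unfolding splits_def
    using W v23(1) Star_And v23(2)[unfolded P_def] world_refl[OF W(5)] world_refl[OF W(2)] by blast
  moreover have "v23 (Star b c)" if bc: "v2 b" "v3 c" for b c
  proof (rule ccontr)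
    assume "\<not> v23 (Star b c)"
    \<comment> \<open>Otherwise \<open>v23\<close> contains the negation, and \<open>P\<close> puts
      it in conjunction with \<open>Star b c\<close> itself. The reflexive equation merely fills the
      place of a formula of \<open>v1\<close>.\<close>
    then have "v (Star (Eq some_var some_var) (And (Neg (Star b c)) (Star b c)))"
      using v23(2)[unfolded P_def] bc world_refl[OF W(4)] by (simp add: world_simps[OF v23(1)])
    then have "v (Star (Eq some_var some_var) Bot)"
      by (rule Star_mono[OF W(3) Imp_refl, rotated]) (rule taut, simp add: tautology_def)
    then show False using Star_Bot2[OF W(3)] by blast
  qed
  ultimately show ?thesis using that W v23(1) unfolding splits_def by blast
qed

section \<open>Equality, allocation and size in a world\<close>

lemma world_Top: "world v \<Longrightarrow> v Top"
  using world_refl world_Neg by metis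

text \<open>The form in which the axioms with antecedent \<open>Star a Top\<close> are used: the
  other part always contains \<open>Top\<close>.\<close>

lemma splits_mono:
  fixes v :: "'v::countable fm \<Rightarrow> bool"
  assumes "splits v1 v2 v" "\<turnstile> Imp (Star a Top) b" "v1 a"
  shows "v b"
  using world_Imp[OF splits_world(3)[OF assms(1)] assms(2)]
    splits_Star[OF assms(1,3) world_Top[OF splits_world(2)[OF assms(1)]]] by blast

text \<open>The parts share the store: equations pass to the whole by \<open>eq_mono\<close>, and
  inequations by \<open>neq_mono\<close>.\<close>

lemma splits_Eq:
  fixes v :: "'v::countable fm \<Rightarrow> bool"
  assumes "splits v1 v2 v"
  shows "v1 (Eq x y) \<longleftrightarrow> v (Eq x y)"
  using splits_mono[OF assms eq_mono] splits_mono[OF assms neq_mono]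
    world_Neg[OF splits_world(1)[OF assms]] world_Neg[OF splits_world(3)[OF assms]] by blast

lemma splits_Alloc:
  fixes v :: "'v::countable fm \<Rightarrow> bool"
  assumes "splits v1 v2 v"
  shows "v (Alloc x) \<longleftrightarrow> v1 (Alloc x) \<or> v2 (Alloc x)"
proof
  note W = splits_world[OF assms]
  assume "v (Alloc x)"
  then have "\<not> v (Star (Neg (Alloc x)) (Neg (Alloc x)))"
    using world_Imp[OF W(3) nalloc_star] world_Neg[OF W(3)] by blast
  then show "v1 (Alloc x) \<or> v2 (Alloc x)"
    using splits_Star[OF assms] world_Neg[OF W(1)] world_Neg[OF W(2)] by blast
next
  show "v (Alloc x)" if "v1 (Alloc x) \<or> v2 (Alloc x)"
    using that splits_mono[OF assms alloc_mono] splits_mono[OF splits_commute[OF assms] alloc_mono]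
    by blast
qed

lemma splits_Alloc_disjoint:
  fixes v :: "'v::countable fm \<Rightarrow> bool"
  assumes "splits v1 v2 v" "v1 (Alloc x)"
  shows "\<not> v2 (Alloc x)"
proof
  note W = splits_world[OF assms(1)]
  assume "v2 (Alloc x)"
  then have "v Bot"
    using splits_Star[OF assms] world_Iff[OF W(3) alloc_disj] by blast
  then show False using world_refl[OF W(3)] world_Neg[OF W(3)] by blast
qed

text \<open>A part keeps the targets of the cells it owns; \<open>npto_star\<close> rules out that a
  pointer of the whole is missing there.\<close>

lemma splits_Pto:
  fixes v :: "'v::countable fm \<Rightarrow> bool"
  assumes "splits v1 v2 v"
  shows "v1 (Pto x y) \<longleftrightarrow> v1 (Alloc x) \<and> v (Pto x y)"
proof -
  note W = splits_world[OF assms]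
  have "v (Pto x y)" if "v1 (Pto x y)"
    using splits_mono[OF assms pto_mono that] .
  moreover have "v1 (Alloc x)" if "v1 (Pto x y)"
    using world_Imp[OF W(1) pto_alloc that] .
  moreover have "\<not> v (Pto x y)" if "v1 (Alloc x)" "\<not> v1 (Pto x y)"
    using splits_mono[OF assms npto_star] that world_simps[OF W(1)] world_Neg[OF W(3)] by blast
  ultimately show ?thesis by blast
qed

section \<open>Congruence of equality in a world\<close>

lemma world_subst:
  assumes v: "world v" and "v (Eq x y)"
  shows "v (subst y x \<phi>) \<longleftrightarrow> v \<phi>"
proof -
  have *: "v (subst y x \<psi>)" if "v \<psi>" for \<psi>
    using world_Imp[OF v eq_subst] that assms(2) world_And[OF v] by blast
  have "subst y x (Neg \<phi>) = Neg (subst y x \<phi>)" by (simp add: subst_def)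
  \<comment> \<open>The axiom gives one direction; its instance for \<open>Neg \<phi>\<close> gives
    the converse.\<close>
  then show ?thesis using *[of \<phi>] *[of "Neg \<phi>"] world_Neg[OF v] by auto
qed

lemma world_Alloc_cong:
  assumes "world v" "v (Eq x y)"
  shows "v (Alloc x) \<longleftrightarrow> v (Alloc y)"
  using world_subst[OF assms, of "Alloc y"] by (simp add: subst_def)

lemma world_Eq_cong:
  assumes "world v" "v (Eq x y)"
  shows "v (Eq x z) \<longleftrightarrow> v (Eq y z)"
proof (cases "z = y")
  \<comment> \<open>Treated apart because here the substitution in \<open>Eq y z\<close> would
    rename \<open>z\<close> as well.\<close>
  case True
  then show ?thesis using assms world_refl[OF assms(1)] by simp
next
  case False
  then show ?thesis using world_subst[OF assms, of "Eq y z"] by (simp add: subst_def)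
qed

lemma world_Eq_sym:
  assumes "world v" "v (Eq x y)"
  shows "v (Eq y x)"
  using world_Eq_cong[OF assms, of x] world_refl[OF assms(1)] by blast

lemma world_Pto_cong:
  assumes v: "world v" and "v (Eq x x')" "v (Eq y y')"
  shows "v (Pto x y) \<longleftrightarrow> v (Pto x' y')"
proof -
  have 1: "v (Pto x y) \<longleftrightarrow> v (Pto x y')" for x
  proof -
    \<comment> \<open>Renaming \<open>y'\<close> to \<open>y\<close> sends both formulae to the same
      one, even if \<open>x\<close> is \<open>y'\<close>.\<close>
    have "v (subst y' y (Pto x y)) \<longleftrightarrow> v (Pto x y)" "v (subst y' y (Pto x y')) \<longleftrightarrow> v (Pto x y')"
      using world_subst[OF v assms(3)] by blast+
    then show ?thesis by (simp add: subst_def split: if_splits)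
  qed
  have "v (subst x' x (Pto x y')) \<longleftrightarrow> v (Pto x y')" "v (subst x' x (Pto x' y')) \<longleftrightarrow> v (Pto x' y')"
    using world_subst[OF v assms(2)] by blast+
  then have "v (Pto x y') \<longleftrightarrow> v (Pto x' y')" by (simp add: subst_def split: if_splits)
  then show ?thesis using 1 by simp
qed

section \<open>Sizes along splittings\<close>

lemma world_size_0: "world v \<Longrightarrow> v (size_ge 0)"
  using world_Top by simp

text \<open>The axiom covers \<open>Neg Emp\<close> only. For larger sizes a nonempty part is split
  off \<open>v1\<close>, and reassociation lets the remainder absorb \<open>v2\<close>.\<close>

lemma splits_size_left:
  fixes v :: "'v::countable fm \<Rightarrow> bool"
  assumes "splits v1 v2 v" "v1 (size_ge n)"
  shows "v (size_ge n)"
  using assms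
proof (induction n arbitrary: v1 v rule: size_ge.induct)
  case 1
  then show ?case using world_size_0 splits_world(3) by blast
next
  case 2
  then show ?case using splits_mono[OF _ nemp_mono] by (simp only: size_ge.simps) blast
next
  case (3 n)
  from 3(3) obtain a b where ab: "splits a b v1" "a (Neg Emp)" "b (size_ge (Suc n))"
    using splits_exist[OF splits_world(1)[OF 3(2)]] by (metis size_ge.simps(3))
  obtain c where c: "splits b v2 c" "splits a c v" using splits_assoc[OF 3(2) ab(1)] .
  have "c (size_ge (Suc n))" using 3(1)[OF c(1) ab(3)] .
  then show ?case using splits_Star[OF c(2) ab(2)] by simp
qed

text \<open>Dropping the nonempty first factor of \<open>size_ge (Suc (Suc j))\<close> leaves a part
  of size at least \<open>Suc j\<close>, and the whole inherits this bound.\<close>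

lemma world_size_mono:
  fixes v :: "'v::countable fm \<Rightarrow> bool"
  assumes v: "world v" and "v (size_ge n)" "m \<le> n"
  shows "v (size_ge m)"
proof -
  have step: "v (size_ge k)" if "v (size_ge (Suc k))" for k
  proof (cases k)
    case 0
    then show ?thesis using world_size_0[OF v] by simp
  next
    case (Suc j)
    with that have "v (Star (Neg Emp) (size_ge (Suc j)))" by simp
    then obtain a b where "splits a b v" "b (size_ge (Suc j))" using splits_exist[OF v] by metis
    then show ?thesis using splits_size_left[OF splits_commute] Suc by blast
  qed
  from assms(3,2) show ?thesis
    by (induction rule: inc_induct) (use step in blast)+
qed

lemma splits_size_add:
  fixes v :: "'v::countable fm \<Rightarrow> bool"
  assumes "splits v1 v2 v" "v1 (size_ge m)" "v2 (size_ge n)"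
  shows "v (size_ge (m + n))"
  using assms
proof (induction m arbitrary: v1 v rule: size_ge.induct)
  case 1
  then show ?case using splits_size_left[OF splits_commute] by simp
next
  case 2
  show ?case
  \<comment> \<open>For \<open>n = 0\<close> the sum is \<open>size_ge 1\<close>, which is not a
    \<open>Star\<close>.\<close>
  proof (cases n)
    case 0
    then show ?thesis using splits_size_left[OF 2(1,2)] by simp
  next
    case (Suc k)
    then show ?thesis using splits_Star[OF 2(1) _ 2(3), of "Neg Emp"] 2(2) by simp
  qed
next
  case (3 m)
  from 3(3) obtain a b where ab: "splits a b v1" "a (Neg Emp)" "b (size_ge (Suc m))"
    using splits_exist[OF splits_world(1)[OF 3(2)]] by (metis size_ge.simps(3))
  obtain c where c: "splits b v2 c" "splits a c v" using splits_assoc[OF 3(2) ab(1)] .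
  have "c (size_ge (Suc m + n))" using 3(1)[OF c(1) ab(3) 3(4)] .
  then show ?case using splits_Star[OF c(2) ab(2)] by simp
qed

text \<open>Upper bounds add up: at most \<open>m - 1\<close> and at most \<open>n - 1\<close> cells
  make at most \<open>m + n - 2\<close>.\<close>

lemma splits_size_less:
  fixes v :: "'v::countable fm \<Rightarrow> bool"
  assumes "splits v1 v2 v" "\<not> v1 (size_ge m)" "\<not> v2 (size_ge n)"
  shows "\<not> v (size_ge (m + n - 1))"
proof -
  note W = splits_world[OF assms(1)]
  have "v (Star (Neg (size_ge m)) (Neg (size_ge n)))"
    using splits_Star[OF assms(1)] assms(2,3) world_Neg[OF W(1)] world_Neg[OF W(2)] by blast
  then show ?thesis using world_Imp[OF W(3) nsize_star] world_Neg[OF W(3)] by blast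
qed

section \<open>Peeling off single cells\<close>

lemma splits_assoc':
  fixes v :: "'v::countable fm \<Rightarrow> bool"
  assumes "splits c w v" "splits a b w"
  obtains d where "splits c a d" "splits d b v"
  using splits_assoc[OF splits_commute[OF assms(1)] splits_commute[OF assms(2)]]
    splits_commute by metis

lemma size_eq_1_iff:
  assumes "world v"
  shows "v (size_eq 1) \<longleftrightarrow> v (size_ge 1) \<and> \<not> v (size_ge 2)"
  unfolding size_eq_def by (simp add: world_simps[OF assms] numeral_2_eq_2 del: size_ge.simps)

text \<open>Removing a part with at most one cell lowers the size by at most one, since
  \<open>2 + n - 1 = Suc n\<close>.\<close>

lemma splits_cell_size:
  fixes v :: "'v::countable fm \<Rightarrow> bool"
  assumes "splits c w v" "\<not> c (size_ge 2)" "v (size_ge (Suc n))"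
  shows "w (size_ge n)"
  using splits_size_less[OF assms(1,2), of n] assms(3) by auto

lemma peel_cell:
  fixes v :: "'v::countable fm \<Rightarrow> bool"
  assumes v: "world v" and "v (size_ge (Suc n))"
  obtains c w where "splits c w v" "c (size_ge 1)" "\<not> c (size_ge 2)" "w (size_ge n)"
proof -
  have "v (size_ge (Suc 0))" by (rule world_size_mono[OF assms]) simp
  then have "v (Neg Emp)" by simp
  then have "v (Star (size_eq 1) Top)" using world_Imp[OF v nemp_size1] by blast
  then obtain c w where cw: "splits c w v" "c (size_eq 1)" using splits_exist[OF v] by metis
  then have "c (size_ge 1)" "\<not> c (size_ge 2)" using size_eq_1_iff[OF splits_world(1)] by blast+
  then show ?thesis using that[OF cw(1)] splits_cell_size[OF cw(1)] assms(2) by blast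
qed

text \<open>By \<open>alloc_size2\<close> a part of size one cannot allocate two distinct locations,
  so every other allocated location stays in the rest.\<close>

lemma peel_Alloc:
  fixes v :: "'v::countable fm \<Rightarrow> bool"
  assumes v: "world v" and "v (Alloc x)"
  obtains c w where "splits c w v" "c (size_ge 1)" "\<not> c (size_ge 2)" "c (Alloc x)"
    "\<And>y. v (Alloc y) \<Longrightarrow> \<not> v (Eq x y) \<Longrightarrow> w (Alloc y)"
proof -
  have "v (Star (And (Alloc x) (size_eq 1)) Top)" using world_Imp[OF v alloc_size1] assms(2) by blast
  then obtain c w where cw: "splits c w v" "c (And (Alloc x) (size_eq 1))"
    using splits_exist[OF v] by metis
  note W = splits_world[OF cw(1)]
  have c: "c (Alloc x)" "c (size_ge 1)" "\<not> c (size_ge 2)"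
    using cw(2) size_eq_1_iff[OF W(1)] world_And[OF W(1)] by blast+
  have "\<not> c (Alloc y)" if "\<not> v (Eq x y)" for y
  proof
    assume "c (Alloc y)"
    moreover have "\<not> c (Eq x y)" using splits_Eq[OF cw(1)] that by blast
    ultimately show False
      using world_Imp[OF W(1) alloc_size2[of x y]] c world_simps[OF W(1)] by blast
  qed
  then show ?thesis using that[OF cw(1)] c splits_Alloc[OF cw(1)] by blast
qed

text \<open>With one variable per location, counting variables counts cells, and cells can be peeled
  off by name.\<close>

definition separated :: "('v fm \<Rightarrow> bool) \<Rightarrow> 'v set \<Rightarrow> bool" where
  "separated v Y \<longleftrightarrow> (\<forall>x\<in>Y. v (Alloc x) \<and> (\<forall>y\<in>Y. v (Eq x y) \<longrightarrow> x = y))"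

lemma peel_separated:
  fixes v :: "'v::countable fm \<Rightarrow> bool"
  assumes v: "world v" and Y: "separated v (insert x Y)" "x \<notin> Y"
  obtains c w where "splits c w v" "c (size_ge 1)" "\<not> c (size_ge 2)" "c (Alloc x)" "separated w Y"
proof -
  have "v (Alloc x)" using Y unfolding separated_def by blast
  then obtain c w where cw: "splits c w v" "c (size_ge 1)" "\<not> c (size_ge 2)" "c (Alloc x)"
    "\<And>y. v (Alloc y) \<Longrightarrow> \<not> v (Eq x y) \<Longrightarrow> w (Alloc y)"
    using peel_Alloc[OF v] by metis
  have "separated w Y"
    using Y cw(5) splits_Eq[OF splits_commute[OF cw(1)]] unfolding separated_def by blast
  then show ?thesis using that[OF cw(1-4)] by blast
qed

lemma separated_card:
  fixes v :: "'v::countable fm \<Rightarrow> bool"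
  assumes "finite Y" "world v" "separated v Y"
  shows "v (size_ge (card Y))"
  using assms
proof (induction Y arbitrary: v rule: finite_induct)
  case empty
  then show ?case using world_size_0 by (metis card.empty)
next
  case (insert x Y)
  then obtain c w where cw: "splits c w v" "c (size_ge 1)" "separated w Y"
    using peel_separated by metis
  have "w (size_ge (card Y))" using insert.IH[OF splits_world(2)[OF cw(1)] cw(3)] .
  then have "v (size_ge (1 + card Y))" using splits_size_add[OF cw(1,2)] by blast
  then show ?case using insert by simp
qed

text \<open>\<open>m\<close> single cells are peeled off and collected in the first part, whose size
  is then exact; everything else goes to the second part.\<close>

lemma split_size:
  fixes v :: "'v::countable fm \<Rightarrow> bool"
  assumes "world v" "v (size_ge (m + n))"
  obtains v1 v2 where "splits v1 v2 v" "v1 (size_ge m)" "\<not> v1 (size_ge (Suc m))" "v2 (size_ge n)"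
proof -
  have "\<exists>v1 v2. splits v1 v2 v \<and> v1 (size_ge m) \<and> \<not> v1 (size_ge (Suc m)) \<and> v2 (size_ge n)"
    using assms
  proof (induction m arbitrary: v)
    case 0
    obtain e where e: "splits e v v" "e Emp" using splits_Emp[OF 0(1)] .
    have "e (size_ge 0)" by (rule world_size_0[OF splits_world(1)[OF e(1)]])
    moreover have "\<not> e (size_ge (Suc 0))"
      using e(2) world_Neg[OF splits_world(1)[OF e(1)], of Emp] by simp
    moreover have "v (size_ge n)" using 0(2) by simp
    ultimately show ?case using e(1) by blast
  next
    case (Suc m)
    obtain c w where cw: "splits c w v" "c (size_ge 1)" "\<not> c (size_ge 2)" "w (size_ge (m + n))"
      using peel_cell[OF Suc(2), of "m + n"] Suc(3) by (metis add_Suc)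
    obtain a b where ab: "splits a b w" "a (size_ge m)" "\<not> a (size_ge (Suc m))" "b (size_ge n)"
      using Suc.IH[OF splits_world(2)[OF cw(1)] cw(4)] by blast
    obtain d where d: "splits c a d" "splits d b v" using splits_assoc'[OF cw(1) ab(1)] .
    have "d (size_ge (Suc m))" "\<not> d (size_ge (Suc (Suc m)))"
      using splits_size_add[OF d(1) cw(2) ab(2)] splits_size_less[OF d(1) cw(3) ab(3)] by simp_all
    then show ?case using d(2) ab(4) by blast
  qed
  then show ?thesis using that by blast
qed

text \<open>A refinement of \<open>split_size\<close>: the cells named by \<open>Y\<close> and then
  those named by \<open>X\<close> are peeled off and added to their parts once the rest is split.
  Each uses one unit of \<open>n\<close> or \<open>m\<close>; \<open>split_size\<close> distributes
  the units left over.\<close>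

lemma split_separated:
  fixes v :: "'v::countable fm \<Rightarrow> bool"
  assumes "world v" "finite X" "finite Y" "X \<inter> Y = {}" "separated v (X \<union> Y)"
    "card X \<le> m" "card Y \<le> n" "v (size_ge (m + n))"
  obtains v1 v2 where "splits v1 v2 v" "v1 (size_ge m)" "\<not> v1 (size_ge (Suc m))" "v2 (size_ge n)"
    "\<And>x. x \<in> X \<Longrightarrow> v1 (Alloc x)" "\<And>y. y \<in> Y \<Longrightarrow> v2 (Alloc y)"
proof -
  have "\<exists>v1 v2. splits v1 v2 v \<and> v1 (size_ge m) \<and> \<not> v1 (size_ge (Suc m)) \<and> v2 (size_ge n)
    \<and> (\<forall>x\<in>X. v1 (Alloc x)) \<and> (\<forall>y\<in>Y. v2 (Alloc y))"
    using assms(3,1,4-)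
  proof (induction Y arbitrary: v n rule: finite_induct)
    case empty
    have "\<exists>v1 v2. splits v1 v2 v \<and> v1 (size_ge m) \<and> \<not> v1 (size_ge (Suc m)) \<and> v2 (size_ge n)
      \<and> (\<forall>x\<in>X. v1 (Alloc x))"
      using assms(2) empty
    proof (induction X arbitrary: v m rule: finite_induct)
      case empty
      then show ?case using split_size[OF empty(1), of m n] by (metis empty_iff)
    next
      case (insert x X)
      obtain k where m: "m = Suc k" "card X \<le> k" using insert by (cases m) auto
      have "separated v (insert x X)" using insert by simp
      then obtain c w where cw: "splits c w v" "c (size_ge 1)" "\<not> c (size_ge 2)" "c (Alloc x)"
          "separated w X" using peel_separated insert by metis
      have w: "w (size_ge (k + n))" using splits_cell_size[OF cw(1,3)] insert m by simp
      obtain a b where ab: "splits a b w" "a (size_ge k)" "\<not> a (size_ge (Suc k))" "b (size_ge n)"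
        "\<forall>x\<in>X. a (Alloc x)"
        using insert.IH[OF splits_world(2)[OF cw(1)], of k] cw w m by auto
      obtain d where d: "splits c a d" "splits d b v" using splits_assoc'[OF cw(1) ab(1)] .
      have "d (size_ge (Suc k))" "\<not> d (size_ge (Suc (Suc k)))"
        using splits_size_add[OF d(1) cw(2) ab(2)] splits_size_less[OF d(1) cw(3) ab(3)] by simp_all
      moreover have "\<forall>x\<in>insert x X. d (Alloc x)" using splits_Alloc[OF d(1)] cw(4) ab(5) by blast
      ultimately show ?case using d(2) ab(4) m by blast
    qed
    then show ?case by simp
  next
    case (insert y Y)
    obtain k where n: "n = Suc k" "card Y \<le> k" using insert by (cases n) auto
    have "separated v (insert y (X \<union> Y))" "y \<notin> X \<union> Y" using insert by auto
    then obtain c w where cw: "splits c w v" "c (size_ge 1)" "\<not> c (size_ge 2)" "c (Alloc y)"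
        "separated w (X \<union> Y)" using peel_separated insert(4) by metis
    have w: "w (size_ge (m + k))" using splits_cell_size[OF cw(1,3)] insert n by simp
    obtain a b where ab: "splits a b w" "a (size_ge m)" "\<not> a (size_ge (Suc m))" "b (size_ge k)"
      "\<forall>x\<in>X. a (Alloc x)" "\<forall>y\<in>Y. b (Alloc y)"
      using insert.IH[OF splits_world(2)[OF cw(1)], of k] cw w n insert by auto
    obtain d where d: "splits c b d" "splits d a v"
      using splits_assoc'[OF cw(1) splits_commute[OF ab(1)]] .
    have "d (size_ge (Suc k))" using splits_size_add[OF d(1) cw(2) ab(4)] by simp
    moreover have "\<forall>y\<in>insert y Y. d (Alloc y)" using splits_Alloc[OF d(1)] cw(4) ab(6) by blast
    ultimately show ?case using splits_commute[OF d(2)] ab n by blast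
  qed
  then show ?thesis using that by blast
qed

section \<open>Comparing worlds with memory states\<close>

text \<open>The sizes are cut off at \<open>B\<close> because a world may contain
  \<open>size_ge n\<close> for every \<open>n\<close>, which no finite heap satisfies.\<close>

definition agree :: "'v set \<Rightarrow> nat \<Rightarrow> ('v fm \<Rightarrow> bool) \<Rightarrow> ('v, 'l) store \<Rightarrow> 'l heap \<Rightarrow> bool" where
  "agree X B v s h \<longleftrightarrow> world v \<and> finite (dom h) \<and>
     (\<forall>x\<in>X. \<forall>y\<in>X. v (Eq x y) \<longleftrightarrow> s x = s y) \<and>
     (\<forall>x\<in>X. v (Alloc x) \<longleftrightarrow> s x \<in> dom h) \<and>
     (\<forall>x\<in>X. \<forall>y\<in>X. v (Pto x y) \<longleftrightarrow> h (s x) = Some (s y)) \<and>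
     (\<forall>n\<le>B. v (size_ge n) \<longleftrightarrow> n \<le> card (dom h))"

lemma agreeD:
  assumes "agree X B v s h"
  shows "world v" "finite (dom h)"
    "x \<in> X \<Longrightarrow> y \<in> X \<Longrightarrow> v (Eq x y) \<longleftrightarrow> s x = s y"
    "x \<in> X \<Longrightarrow> v (Alloc x) \<longleftrightarrow> s x \<in> dom h"
    "x \<in> X \<Longrightarrow> y \<in> X \<Longrightarrow> v (Pto x y) \<longleftrightarrow> h (s x) = Some (s y)"
    "n \<le> B \<Longrightarrow> v (size_ge n) \<longleftrightarrow> n \<le> card (dom h)"
  using assms unfolding agree_def by blast+

lemma agree_mono: "agree X B v s h \<Longrightarrow> B' \<le> B \<Longrightarrow> agree X B' v s h"
  unfolding agree_def by (meson order_trans)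

lemma dom_restrict_subset: "D \<subseteq> dom h \<Longrightarrow> dom (h |` D) = D"
  by auto

text \<open>Equations and pointers of a part are determined by the whole and by what the part
  allocates, so only allocation and size have to be compared.\<close>

lemma agree_restrict:
  fixes v :: "'v::countable fm \<Rightarrow> bool"
  assumes ag: "agree X B v s h" and sp: "splits v1 v2 v" and D: "D \<subseteq> dom h"
    and alloc: "\<And>x. x \<in> X \<Longrightarrow> v1 (Alloc x) \<longleftrightarrow> s x \<in> D"
    and size: "\<And>n. n \<le> B1 \<Longrightarrow> v1 (size_ge n) \<longleftrightarrow> n \<le> card D"
  shows "agree X B1 v1 s (h |` D)"
  unfolding agree_def dom_restrict_subset[OF D]
proof (intro conjI ballI allI impI)
  show "world v1" using splits_world[OF sp] by blast
  show "finite D" using D agreeD(2)[OF ag] finite_subset by blast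
  fix x assume x: "x \<in> X"
  show "v1 (Alloc x) \<longleftrightarrow> s x \<in> D" using alloc[OF x] .
  fix y assume y: "y \<in> X"
  show "v1 (Eq x y) \<longleftrightarrow> s x = s y" using splits_Eq[OF sp] agreeD(3)[OF ag x y] by blast
  show "v1 (Pto x y) \<longleftrightarrow> (h |` D) (s x) = Some (s y)"
    using splits_Pto[OF sp] agreeD(5)[OF ag x y] alloc[OF x] by (auto simp: restrict_map_def)
qed (use size in auto)

text \<open>Keeping one variable for each location removes the aliases.\<close>

lemma separated_representatives:
  assumes "\<And>x y. x \<in> Z \<Longrightarrow> y \<in> Z \<Longrightarrow> v (Eq x y) \<longleftrightarrow> s x = s y" "\<And>x. x \<in> Z \<Longrightarrow> v (Alloc x)"
  obtains R where "R \<subseteq> Z" "inj_on s R" "s ` R = s ` Z" "separated v R"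
proof -
  obtain R where R: "R \<subseteq> Z" "inj_on s R" "s ` R = s ` Z"
    using subset_image_inj[of "s ` Z" s Z] by auto
  then have "separated v R" unfolding separated_def using assms by (metis inj_onD subsetD)
  then show ?thesis using that R by blast
qed

lemma size_alloc:
  fixes v :: "'v::countable fm \<Rightarrow> bool"
  assumes "world v" "finite Z"
    "\<And>x y. x \<in> Z \<Longrightarrow> y \<in> Z \<Longrightarrow> v (Eq x y) \<longleftrightarrow> s x = s y" "\<And>x. x \<in> Z \<Longrightarrow> v (Alloc x)"
  shows "v (size_ge (card (s ` Z)))"
proof -
  obtain R where R: "R \<subseteq> Z" "inj_on s R" "s ` R = s ` Z" "separated v R"
    using separated_representatives[of Z v s] assms by blast
  have "finite R" using R(1) assms(2) by (rule finite_subset)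
  then have "v (size_ge (card R))" using assms(1) R(4) by (rule separated_card)
  moreover have "card R = card (s ` Z)" using card_image[OF R(2)] R(3) by simp
  ultimately show ?thesis by simp
qed

text \<open>By monotonicity, \<open>d\<close> is one less than the least refuted size, which is
  positive because \<open>size_ge 0\<close> holds in every world.\<close>

lemma size_exact:
  fixes v :: "'v::countable fm \<Rightarrow> bool"
  assumes v: "world v" and "\<not> v (size_ge n)"
  obtains d where "d < n" "\<And>k. v (size_ge k) \<longleftrightarrow> k \<le> d"
proof -
  define m where "m = (LEAST k. \<not> v (size_ge k))"
  have m: "\<not> v (size_ge m)" unfolding m_def using assms(2) by (rule LeastI)
  have "m \<le> n" unfolding m_def using assms(2) by (rule Least_le)
  have "m \<noteq> 0" using m world_size_0[OF v] by metis
  then have d: "v (size_ge (m - 1))" using not_less_Least[of "m - 1" "\<lambda>k. \<not> v (size_ge k)"]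
    unfolding m_def by auto
  have "v (size_ge k) \<longleftrightarrow> k \<le> m - 1" for k
  proof
    assume "v (size_ge k)"
    then have "\<not> m \<le> k" using world_size_mono[OF v] m by blast
    then show "k \<le> m - 1" by simp
  qed (use world_size_mono[OF v d] in blast)
  then show ?thesis using that[of "m - 1"] \<open>m \<noteq> 0\<close> \<open>m \<le> n\<close> by simp
qed

text \<open>Finds how many of \<open>d\<close> cells the first part should get. If one part stays
  below its bound, its exact size settles the matter; if both reach their bounds, then
  \<open>B1 + B2 \<le> d\<close> and \<open>d1 = B1\<close> will do. The numbers \<open>m1\<close>
  and \<open>m2\<close> reserve room for named cells.\<close>

lemma splits_sizes_match:
  fixes v :: "'v::countable fm \<Rightarrow> bool"
  assumes sp: "splits v1 v2 v" and d: "\<And>n. n \<le> B1 + B2 \<Longrightarrow> v (size_ge n) \<longleftrightarrow> n \<le> d"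
    and m1: "m1 \<le> B1" "v1 (size_ge m1)" and m2: "m2 \<le> B2" "v2 (size_ge m2)"
  obtains d1 where "m1 \<le> d1" "d1 \<le> d" "m2 \<le> d - d1"
    "\<And>n. n \<le> B1 \<Longrightarrow> v1 (size_ge n) \<longleftrightarrow> n \<le> d1" "\<And>n. n \<le> B2 \<Longrightarrow> v2 (size_ge n) \<longleftrightarrow> n \<le> d - d1"
proof -
  have half: "\<exists>d1\<le>d. m1 \<le> d1 \<and> m2 \<le> d - d1 \<and> (\<forall>n\<le>B1. v1 (size_ge n) \<longleftrightarrow> n \<le> d1) \<and>
      (\<forall>n\<le>B2. v2 (size_ge n) \<longleftrightarrow> n \<le> d - d1)"
    if sp: "splits v1 v2 v" and d: "\<And>n. n \<le> B1 + B2 \<Longrightarrow> v (size_ge n) \<longleftrightarrow> n \<le> d"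
      and m1: "m1 \<le> B1" "v1 (size_ge m1)" and m2: "m2 \<le> B2" "v2 (size_ge m2)"
      and B1: "\<not> v1 (size_ge B1)" for v1 v2 :: "'v fm \<Rightarrow> bool" and B1 B2 m1 m2 :: nat
  proof -
    obtain d1 where d1: "d1 < B1" "\<And>k. v1 (size_ge k) \<longleftrightarrow> k \<le> d1"
      using size_exact[OF splits_world(1)[OF sp] B1] by blast
    have v1: "v1 (size_ge d1)" "\<not> v1 (size_ge (Suc d1))" using d1 by auto
    have v2: "v2 (size_ge n) \<longleftrightarrow> d1 + n \<le> d" if "n \<le> B2" for n
    proof -
      \<comment> \<open>The first part has exactly \<open>d1\<close> cells, so the second has the
        remaining ones; \<open>d1 < B1\<close> keeps \<open>d1 + n\<close> within the range where
        \<open>v\<close> is compared with \<open>d\<close>.\<close>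
      have "v2 (size_ge n) \<longleftrightarrow> v (size_ge (d1 + n))"
        using splits_size_add[OF sp v1(1)] splits_size_less[OF sp v1(2), of n] by auto
      then show ?thesis using d that d1(1) by simp
    qed
    have "d1 \<le> d" using v2[of 0] world_size_0[OF splits_world(2)[OF sp]] by simp
    moreover have "m1 \<le> d1" using d1 m1 by blast
    moreover have "m2 \<le> d - d1" using v2[OF m2(1)] m2 by simp
    moreover have "v2 (size_ge n) \<longleftrightarrow> n \<le> d - d1" if "n \<le> B2" for n
      using v2[OF that] \<open>d1 \<le> d\<close> by linarith
    ultimately show ?thesis using d1(2) by blast
  qed
  consider "\<not> v1 (size_ge B1)" | "\<not> v2 (size_ge B2)" | "v1 (size_ge B1)" "v2 (size_ge B2)" by blast
  then show ?thesis
  proof cases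
    case 1
    then show ?thesis using half[OF sp d m1 m2] that by blast
  next
    case 2
    have "\<exists>d2\<le>d. m2 \<le> d2 \<and> m1 \<le> d - d2 \<and> (\<forall>n\<le>B2. v2 (size_ge n) \<longleftrightarrow> n \<le> d2) \<and>
      (\<forall>n\<le>B1. v1 (size_ge n) \<longleftrightarrow> n \<le> d - d2)"
      using half[OF splits_commute[OF sp] _ m2 m1 2] d by (simp add: add.commute)
    then obtain d2 where "d2 \<le> d" "m2 \<le> d2" "m1 \<le> d - d2" "\<forall>n\<le>B2. v2 (size_ge n) \<longleftrightarrow> n \<le> d2"
      "\<forall>n\<le>B1. v1 (size_ge n) \<longleftrightarrow> n \<le> d - d2" by blast
    then show ?thesis using that[of "d - d2"] by simp
  next
    case 3
    then have "v (size_ge (B1 + B2))" using splits_size_add[OF sp] by blast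
    then have le: "B1 + B2 \<le> d" using d by simp
    have "v1 (size_ge n)" if "n \<le> B1" for n using world_size_mono[OF splits_world(1)[OF sp] 3(1) that] .
    moreover have "v2 (size_ge n)" if "n \<le> B2" for n
      using world_size_mono[OF splits_world(2)[OF sp] 3(2) that] .
    ultimately show ?thesis using that[of B1] le m1 m2 by simp
  qed
qed

text \<open>The set \<open>D\<close> has to contain the named locations of \<open>v1\<close>, avoid
  those of \<open>v2\<close> and have the size given by \<open>splits_sizes_match\<close>. The
  bounds on \<open>card X\<close> ensure that named cells count among the compared sizes.\<close>

lemma agree_forth:
  fixes v :: "'v::countable fm \<Rightarrow> bool"
  assumes X: "finite X" "card X \<le> B1" "card X \<le> B2" and ag: "agree X (B1 + B2) v s h"
    and sp: "splits v1 v2 v"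
  obtains D where "D \<subseteq> dom h" "agree X B1 v1 s (h |` D)" "agree X B2 v2 s (h |` (dom h - D))"
proof -
  note sp' = splits_commute[OF sp]
  define M1 where "M1 = s ` {x\<in>X. v1 (Alloc x)}"
  define M2 where "M2 = s ` {x\<in>X. v2 (Alloc x)}"
  have M1: "v1 (Alloc x) \<longleftrightarrow> s x \<in> M1" if "x \<in> X" for x
  proof -
    have "v1 (Alloc x)" if "y \<in> X" "v1 (Alloc y)" "s x = s y" for y
      using world_Alloc_cong[OF splits_world(1)[OF sp], of x y] splits_Eq[OF sp, of x y]
        agreeD(3)[OF ag \<open>x \<in> X\<close> that(1)] that by simp
    then show ?thesis using \<open>x \<in> X\<close> unfolding M1_def by blast
  qed
  have M2: "v2 (Alloc x) \<longleftrightarrow> s x \<in> M2" if "x \<in> X" for x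
  proof -
    have "v2 (Alloc x)" if "y \<in> X" "v2 (Alloc y)" "s x = s y" for y
      using world_Alloc_cong[OF splits_world(2)[OF sp], of x y] splits_Eq[OF sp', of x y]
        agreeD(3)[OF ag \<open>x \<in> X\<close> that(1)] that by simp
    then show ?thesis using \<open>x \<in> X\<close> unfolding M2_def by blast
  qed
  have disj: "M1 \<inter> M2 = {}"
    using M1 splits_Alloc_disjoint[OF sp] unfolding M2_def by blast
  have un: "M1 \<union> M2 = s ` X \<inter> dom h"
    using agreeD(4)[OF ag] splits_Alloc[OF sp] unfolding M1_def M2_def by blast
  have fin: "finite M1" "finite M2" using X(1) unfolding M1_def M2_def by auto
  have "card M1 \<le> card X" "card M2 \<le> card X"
    using X(1) card_image_le[of "{x\<in>X. v1 (Alloc x)}" s] card_image_le[of "{x\<in>X. v2 (Alloc x)}" s]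
      card_mono[of X "{x\<in>X. v1 (Alloc x)}"] card_mono[of X "{x\<in>X. v2 (Alloc x)}"]
    unfolding M1_def M2_def by auto
  then have le: "card M1 \<le> B1" "card M2 \<le> B2" using X by auto
  have s1: "v1 (size_ge (card M1))" unfolding M1_def
  proof (rule size_alloc[OF splits_world(1)[OF sp]])
    show "v1 (Eq x y) \<longleftrightarrow> s x = s y" if "x \<in> {x\<in>X. v1 (Alloc x)}" "y \<in> {x\<in>X. v1 (Alloc x)}" for x y
      using splits_Eq[OF sp, of x y] agreeD(3)[OF ag, of x y] that by simp
  qed (use X(1) in auto)
  have s2: "v2 (size_ge (card M2))" unfolding M2_def
  proof (rule size_alloc[OF splits_world(2)[OF sp]])
    show "v2 (Eq x y) \<longleftrightarrow> s x = s y" if "x \<in> {x\<in>X. v2 (Alloc x)}" "y \<in> {x\<in>X. v2 (Alloc x)}" for x y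
      using splits_Eq[OF sp', of x y] agreeD(3)[OF ag, of x y] that by simp
  qed (use X(1) in auto)
  obtain d1 where d1: "card M1 \<le> d1" "d1 \<le> card (dom h)" "card M2 \<le> card (dom h) - d1"
    "\<And>n. n \<le> B1 \<Longrightarrow> v1 (size_ge n) \<longleftrightarrow> n \<le> d1"
    "\<And>n. n \<le> B2 \<Longrightarrow> v2 (size_ge n) \<longleftrightarrow> n \<le> card (dom h) - d1"
    using splits_sizes_match[OF sp agreeD(6)[OF ag] le(1) s1 le(2) s2] by blast
  have "card (dom h - M2) = card (dom h) - card M2"
    using un fin by (intro card_Diff_subset) auto
  \<comment> \<open>There is room for \<open>d1\<close> locations outside \<open>M2\<close>, so
    \<open>M1\<close> can be enlarged to that size without touching \<open>M2\<close>.\<close>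
  then have "d1 \<le> card (dom h - M2)" using d1(2,3) by linarith
  moreover have "M1 \<subseteq> dom h - M2" using un disj by blast
  ultimately obtain D where D: "M1 \<subseteq> D" "D \<subseteq> dom h - M2" "card D = d1"
    using exists_subset_between[OF d1(1)] agreeD(2)[OF ag] by (metis finite_Diff)
  have fD: "finite D" using D(2) agreeD(2)[OF ag] finite_subset by blast
  have cD: "card (dom h - D) = card (dom h) - d1"
    using D fD by (subst card_Diff_subset) auto
  have Dh: "D \<subseteq> dom h" using D by blast
  have "agree X B1 v1 s (h |` D)"
  proof (rule agree_restrict[OF ag sp Dh])
    fix x assume x: "x \<in> X"
    show "v1 (Alloc x) \<longleftrightarrow> s x \<in> D" using M1[OF x] D un x by blast
  qed (use d1(4) D(3) in auto)
  moreover have "agree X B2 v2 s (h |` (dom h - D))"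
  proof (rule agree_restrict[OF ag sp'])
    fix x assume x: "x \<in> X"
    show "v2 (Alloc x) \<longleftrightarrow> s x \<in> dom h - D" using M2[OF x] D un x by blast
  qed (use d1(5) cD in auto)
  ultimately show ?thesis using that Dh by blast
qed

text \<open>Representatives of the named locations on both sides of the heap splitting tell
  \<open>split_separated\<close> which cells go where; the sizes asked for are those of the two
  sides, cut off at \<open>B1\<close> and \<open>B2\<close>.\<close>

lemma agree_back:
  fixes v :: "'v::countable fm \<Rightarrow> bool"
  assumes X: "finite X" "card X \<le> B1" "card X \<le> B2" and ag: "agree X (B1 + B2) v s h"
    and D: "D \<subseteq> dom h"
  obtains v1 v2 where "splits v1 v2 v" "agree X B1 v1 s (h |` D)" "agree X B2 v2 s (h |` (dom h - D))"
proof -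
  \<comment> \<open>\<open>split_separated\<close> makes only the first size exact. Under the last
    assumption this suffices: either the first side is below its bound and fixes the second by
    subtraction, or no upper bound on the second is visible.\<close>
  have half: "\<exists>v1 v2. splits v1 v2 v \<and> agree X B1 v1 s (h |` D) \<and> agree X B2 v2 s (h |` E)"
    if D: "D \<union> E = dom h" "D \<inter> E = {}" and B: "card X \<le> B1" "card X \<le> B2"
      and ag: "agree X (B1 + B2) v s h" and c: "card D < B1 \<or> B2 \<le> card E" for B1 B2 D E
  proof -
    have fin: "finite D" "finite E"
      using D(1) agreeD(2)[OF ag] finite_Un[of D E] by simp_all
    have card: "card (dom h) = card D + card E"
      using card_Un_disjoint[OF fin D(2)] D(1) by simp
    have ex: "\<exists>P. P \<subseteq> {x\<in>X. s x \<in> F} \<and> inj_on s P \<and> s ` P = s ` {x\<in>X. s x \<in> F} \<and> separated v P"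
      if F: "F \<subseteq> dom h" for F
    proof (rule separated_representatives[of "{x\<in>X. s x \<in> F}" v s])
      show "v (Eq x y) \<longleftrightarrow> s x = s y" if "x \<in> {x\<in>X. s x \<in> F}" "y \<in> {x\<in>X. s x \<in> F}" for x y
        using agreeD(3)[OF ag, of x y] that by simp
      show "v (Alloc x)" if "x \<in> {x\<in>X. s x \<in> F}" for x
        using agreeD(4)[OF ag, of x] that F by blast
    qed blast
    obtain P where P: "P \<subseteq> {x\<in>X. s x \<in> D}" "inj_on s P" "s ` P = s ` {x\<in>X. s x \<in> D}" "separated v P"
      using ex[of D] D(1) by blast
    obtain Q where Q: "Q \<subseteq> {x\<in>X. s x \<in> E}" "inj_on s Q" "s ` Q = s ` {x\<in>X. s x \<in> E}" "separated v Q"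
      using ex[of E] D(1) by blast
    have PQ: "P \<inter> Q = {}" using P(1) Q(1) D(2) by blast
    have finPQ: "finite P" "finite Q"
      using P(1) Q(1) X(1) finite_subset[of P X] finite_subset[of Q X] by blast+
    have "\<not> v (Eq x y) \<and> \<not> v (Eq y x)" if "x \<in> P" "y \<in> Q" for x y
    proof -
      have "x \<in> X" "s x \<in> D" "y \<in> X" "s y \<in> E" using that P(1) Q(1) by blast+
      moreover from this have "s x \<noteq> s y" using D(2) by auto
      ultimately show ?thesis using agreeD(3)[OF ag] by simp
    qed
    with P(4) Q(4) have sep: "separated v (P \<union> Q)" unfolding separated_def by blast
    have "card P \<le> card X" "card Q \<le> card X" using P(1) Q(1) X(1) by (auto intro!: card_mono)
    moreover have "card P \<le> card D" by (rule card_inj_on_le[OF P(2) _ fin(1)]) (use P(1) in blast)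
    moreover have "card Q \<le> card E" by (rule card_inj_on_le[OF Q(2) _ fin(2)]) (use Q(1) in blast)
    ultimately have le: "card P \<le> min (card D) B1" "card Q \<le> min (card E) B2" using B by auto
    \<comment> \<open>The sum is at most \<open>B1 + B2\<close>, hence visible to the agreement, and
      at most \<open>card (dom h)\<close>.\<close>
    have "v (size_ge (min (card D) B1 + min (card E) B2))"
      using agreeD(6)[OF ag, of "min (card D) B1 + min (card E) B2"] card by auto
    then obtain v1 v2 where v12: "splits v1 v2 v" "v1 (size_ge (min (card D) B1))"
      "\<not> v1 (size_ge (Suc (min (card D) B1)))" "v2 (size_ge (min (card E) B2))"
      "\<And>x. x \<in> P \<Longrightarrow> v1 (Alloc x)" "\<And>y. y \<in> Q \<Longrightarrow> v2 (Alloc y)"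
      using split_separated[OF agreeD(1)[OF ag] finPQ PQ sep le] by metis
    note W = splits_world[OF v12(1)] and sp' = splits_commute[OF v12(1)]
    have a1: "v1 (Alloc x)" if x: "x \<in> X" "s x \<in> D" for x
    proof -
      obtain p where p: "p \<in> P" "s p = s x" using P(3) x by (metis (mono_tags, lifting) imageE image_eqI mem_Collect_eq)
      then have "v1 (Eq p x)" using splits_Eq[OF v12(1)] agreeD(3)[OF ag, of p x] P(1) x by auto
      then show ?thesis using world_Alloc_cong[OF W(1)] v12(5) p by blast
    qed
    have a2: "v2 (Alloc x)" if x: "x \<in> X" "s x \<in> E" for x
    proof -
      obtain p where p: "p \<in> Q" "s p = s x" using Q(3) x by (metis (mono_tags, lifting) imageE image_eqI mem_Collect_eq)
      then have "v2 (Eq p x)" using splits_Eq[OF sp'] agreeD(3)[OF ag, of p x] Q(1) x by auto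
      then show ?thesis using world_Alloc_cong[OF W(2)] v12(6) p by blast
    qed
    have alloc: "(v1 (Alloc x) \<longleftrightarrow> s x \<in> D) \<and> (v2 (Alloc x) \<longleftrightarrow> s x \<in> E)" if x: "x \<in> X" for x
      using a1[OF x] a2[OF x] splits_Alloc[OF v12(1), of x] splits_Alloc_disjoint[OF v12(1), of x]
        agreeD(4)[OF ag x] D by blast
    have z1: "v1 (size_ge n) \<longleftrightarrow> n \<le> card D" if n: "n \<le> B1" for n
    proof
      assume "v1 (size_ge n)"
      then have "\<not> Suc (min (card D) B1) \<le> n" using world_size_mono[OF W(1)] v12(3) by blast
      then show "n \<le> card D" by simp
    next
      assume "n \<le> card D"
      then show "v1 (size_ge n)" using world_size_mono[OF W(1) v12(2)] n by simp
    qed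
    have z2: "v2 (size_ge n) \<longleftrightarrow> n \<le> card E" if n: "n \<le> B2" for n
    proof
      assume v2: "v2 (size_ge n)"
      show "n \<le> card E"
      proof (rule ccontr)
        assume "\<not> n \<le> card E"
        then have lt: "card D < B1" using c n by linarith
        then have "v (size_ge (card D + n))" using splits_size_add[OF v12(1) _ v2, of "card D"] v12(2) by simp
        then have "card D + n \<le> card (dom h)" using agreeD(6)[OF ag, of "card D + n"] lt n by simp
        then show False using \<open>\<not> n \<le> card E\<close> card by simp
      qed
    next
      assume "n \<le> card E"
      then show "v2 (size_ge n)" using world_size_mono[OF W(2) v12(4)] n by simp
    qed
    have "agree X B1 v1 s (h |` D)"
      by (rule agree_restrict[OF ag v12(1)]) (use D alloc z1 in auto)
    moreover have "agree X B2 v2 s (h |` E)"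
      by (rule agree_restrict[OF ag sp']) (use D alloc z2 in auto)
    ultimately show ?thesis using v12(1) by blast
  qed
  have "D \<union> (dom h - D) = dom h" "D \<inter> (dom h - D) = {}" "(dom h - D) \<union> D = dom h" "(dom h - D) \<inter> D = {}"
    using D by blast+
  note E = this
  show ?thesis
  proof (cases "card D < B1 \<or> B2 \<le> card (dom h - D)")
    case True
    then show ?thesis using half[OF E(1,2) X(2,3) ag] that by blast
  next
    case False
    \<comment> \<open>The assumption of \<open>half\<close> holds with the two sides
      exchanged.\<close>
    then have "card (dom h - D) < B2 \<or> B1 \<le> card D" by linarith
    then show ?thesis using half[OF E(3,4) X(3,2)] ag that splits_commute by (metis add.commute)
  qed
qed

text \<open>\<open>Star\<close> adds the bounds because the back-and-forth lemmas divide
  \<open>B1 + B2\<close>. The value \<open>k\<close> at atoms keeps every bound at least the number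
  of variables.\<close>

fun size_bound :: "nat \<Rightarrow> 'v fm \<Rightarrow> nat" where
  "size_bound k (Neg \<phi>) = size_bound k \<phi>"
| "size_bound k (And \<phi> \<psi>) = max (size_bound k \<phi>) (size_bound k \<psi>)"
| "size_bound k (Star \<phi> \<psi>) = size_bound k \<phi> + size_bound k \<psi>"
| "size_bound k _ = k"

lemma size_bound_ge: "k \<le> size_bound k \<phi>"
  by (induction \<phi>) auto

lemma agree_sat:
  fixes v :: "'v::countable fm \<Rightarrow> bool"
  assumes X: "finite X" "card X \<le> k" "0 < k"
    and "set_fm \<phi> \<subseteq> X" "agree X B v s h" "size_bound k \<phi> \<le> B"
  shows "v \<phi> \<longleftrightarrow> sat s h \<phi>"
  using assms(4-)
proof (induction \<phi> arbitrary: B v h)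
  case Emp
  \<comment> \<open>Emptiness is read off from size one, which is compared because \<open>k\<close>
    is positive.\<close>
  then have "v (size_ge 1) \<longleftrightarrow> 1 \<le> card (dom h)" using agreeD(6)[OF Emp(2), of 1] X(3) by simp
  then show ?case
    using world_Neg[OF agreeD(1)[OF Emp(2)], of Emp] agreeD(2)[OF Emp(2)]
    by (auto simp: Suc_le_eq card_gt_0_iff)
next
  case (Neg \<phi>)
  then show ?case using world_Neg[OF agreeD(1)[OF Neg.prems(2)]] by simp
next
  case (And \<phi> \<psi>)
  then show ?case using world_And[OF agreeD(1)[OF And.prems(2)]] by simp
next
  case (Star \<phi> \<psi>)
  let ?B1 = "size_bound k \<phi>" and ?B2 = "size_bound k \<psi>"
  have ag: "agree X (?B1 + ?B2) v s h" using agree_mono[OF Star.prems(2)] Star.prems(3) by simp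
  have sub: "set_fm \<phi> \<subseteq> X" "set_fm \<psi> \<subseteq> X" using Star.prems(1) by auto
  have le: "card X \<le> ?B1" "card X \<le> ?B2" using X(2) size_bound_ge order_trans by blast+
  show ?case
  proof
    assume "v (Star \<phi> \<psi>)"
    then obtain v1 v2 where v12: "splits v1 v2 v" "v1 \<phi>" "v2 \<psi>"
      using splits_exist[OF agreeD(1)[OF ag]] by metis
    obtain D where D: "D \<subseteq> dom h" "agree X ?B1 v1 s (h |` D)" "agree X ?B2 v2 s (h |` (dom h - D))"
      using agree_forth[OF X(1) le ag v12(1)] .
    show "sat s h (Star \<phi> \<psi>)"
      unfolding sat_Star_iff
      using D(1) Star.IH(1)[OF sub(1) D(2)] Star.IH(2)[OF sub(2) D(3)] v12 by blast
  next
    assume "sat s h (Star \<phi> \<psi>)"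
    then obtain D where D: "D \<subseteq> dom h" "sat s (h |` D) \<phi>" "sat s (h |` (dom h - D)) \<psi>"
      unfolding sat_Star_iff by blast
    obtain v1 v2 where v12: "splits v1 v2 v" "agree X ?B1 v1 s (h |` D)"
      "agree X ?B2 v2 s (h |` (dom h - D))"
      using agree_back[OF X(1) le ag D(1)] .
    show "v (Star \<phi> \<psi>)"
      using splits_Star[OF v12(1)] D Star.IH(1)[OF sub(1) v12(2)] Star.IH(2)[OF sub(2) v12(3)] by blast
  qed
qed (simp_all add: agreeD)

text \<open>The store names equality classes; the heap has the allocated named cells, padded with
  unnamed ones up to the required size.\<close>

lemma agree_realizable:
  fixes v :: "'v::countable fm \<Rightarrow> bool"
  assumes v: "world v" and X: "finite X" "card X \<le> B"
  obtains s :: "('v, 'l::infinite) store" and h where "agree X B v s h"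
proof -
  obtain f :: "nat \<Rightarrow> 'l" where f: "inj f"
    using infinite_countable_subset[OF infinite_UNIV] by blast
  \<comment> \<open>Variables equal in \<open>v\<close> have the same class, hence the same chosen
    representative, and the injection \<open>f\<close> turns representatives into locations.\<close>
  define s where "s x = f (to_nat (SOME y. v (Eq x y)))" for x
  have s: "s x = s y \<longleftrightarrow> v (Eq x y)" for x y
  proof
    assume "s x = s y"
    then have "(SOME z. v (Eq x z)) = (SOME z. v (Eq y z))"
      unfolding s_def using f by (simp add: inj_eq)
    moreover have "v (Eq x (SOME z. v (Eq x z)))" "v (Eq y (SOME z. v (Eq y z)))"
      using someI[of "\<lambda>z. v (Eq _ z)", OF world_refl[OF v]] by blast+
    ultimately show "v (Eq x y)"
      using world_Eq_cong[OF v] world_Eq_sym[OF v] by metis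
  next
    assume "v (Eq x y)"
    then have "(\<lambda>z. v (Eq x z)) = (\<lambda>z. v (Eq y z))" using world_Eq_cong[OF v] by blast
    then show "s x = s y" unfolding s_def by metis
  qed
  define M where "M = s ` {x\<in>X. v (Alloc x)}"
  have M: "s x \<in> M \<longleftrightarrow> v (Alloc x)" if "x \<in> X" for x
    using that s world_Alloc_cong[OF v] unfolding M_def by auto
  have "card M \<le> card X"
    using X(1) card_image_le[of "{x\<in>X. v (Alloc x)}" s] card_mono[of X "{x\<in>X. v (Alloc x)}"]
    unfolding M_def by auto
  then have MB: "card M \<le> B" using X by simp
  have vM: "v (size_ge (card M))" unfolding M_def
    by (rule size_alloc[OF v]) (use X(1) s in auto)
  \<comment> \<open>The heap size to aim at: \<open>B\<close> if \<open>v\<close> contains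
    \<open>size_ge B\<close>, and the exact size otherwise.\<close>
  have "\<exists>d\<ge>card M. \<forall>n\<le>B. v (size_ge n) \<longleftrightarrow> n \<le> d"
  proof (cases "v (size_ge B)")
    case True
    then show ?thesis using MB world_size_mono[OF v] by (intro exI[of _ B]) blast
  next
    case False
    then obtain d where "\<And>k. v (size_ge k) \<longleftrightarrow> k \<le> d" using size_exact[OF v] by metis
    then show ?thesis using vM by blast
  qed
  then obtain d where d: "card M \<le> d" "\<And>n. n \<le> B \<Longrightarrow> v (size_ge n) \<longleftrightarrow> n \<le> d" by blast
  have finX: "finite (s ` X)" "finite M" using X(1) unfolding M_def by auto
  have inf: "infinite (- s ` X)" using finX(1) infinite_UNIV by (simp add: Compl_eq_Diff_UNIV)
  obtain A where A: "finite A" "card A = d - card M" "A \<subseteq> - s ` X"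
    using infinite_arbitrarily_large[OF inf] by blast
  have "- s ` X \<noteq> {}" using inf by (metis finite.emptyI)
  then obtain l where l: "l \<notin> s ` X" by blast
  \<comment> \<open>A cell points where \<open>v\<close> says. Without such a pointer it gets the
    dummy target \<open>l\<close>, which no variable of \<open>X\<close> names, so no pointer
    formula over \<open>X\<close> becomes true by accident.\<close>
  define h where "h a = (if a \<in> M \<union> A then
      Some (if \<exists>x\<in>X. \<exists>y\<in>X. s x = a \<and> v (Pto x y)
            then s (SOME y. y \<in> X \<and> (\<exists>x\<in>X. s x = a \<and> v (Pto x y))) else l) else None)" for a
  have dom: "dom h = M \<union> A" unfolding h_def by (auto split: if_splits)
  have "M \<inter> A = {}" using A(3) unfolding M_def by auto
  then have card: "card (dom h) = d" using A finX d(1) unfolding dom by (simp add: card_Un_disjoint)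
  have "agree X B v s h" unfolding agree_def card
  proof (intro conjI ballI allI impI)
    show "finite (dom h)" using dom A finX by simp
    fix x assume x: "x \<in> X"
    show "v (Alloc x) \<longleftrightarrow> s x \<in> dom h" using M[OF x] A(3) x dom by blast
    fix y assume y: "y \<in> X"
    show "v (Pto x y) \<longleftrightarrow> h (s x) = Some (s y)"
    proof (cases "\<exists>x'\<in>X. \<exists>y\<in>X. s x' = s x \<and> v (Pto x' y)")
      case True
      define y' where "y' = (SOME y. y \<in> X \<and> (\<exists>x'\<in>X. s x' = s x \<and> v (Pto x' y)))"
      have "y' \<in> X \<and> (\<exists>x'\<in>X. s x' = s x \<and> v (Pto x' y'))"
        unfolding y'_def by (rule someI_ex) (use True in blast)
      then have y': "y' \<in> X" "v (Pto x y')"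
        using s world_Pto_cong[OF v _ world_refl[OF v]] by auto
      then have "v (Alloc x)" using world_Imp[OF v pto_alloc] by blast
      then have "h (s x) = Some (s y')" using M[OF x] True unfolding h_def y'_def by simp
      moreover have "v (Pto x y) \<longleftrightarrow> s y' = s y"
      proof
        assume "v (Pto x y)"
        then show "s y' = s y" using world_Imp[OF v pto_fun] y' world_And[OF v] s by blast
      next
        assume "s y' = s y"
        then show "v (Pto x y)" using s y' world_Pto_cong[OF v world_refl[OF v]] by blast
      qed
      ultimately show ?thesis by simp
    next
      case False
      then have "\<not> v (Pto x y)" using x y by blast
      moreover have "h (s x) = None \<or> h (s x) = Some l" using False unfolding h_def by auto
      ultimately show ?thesis using l y by auto
    qed
  qed (use v s d in auto)
  then show ?thesis using that by blast
qed

section \<open>Completeness\<close>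

lemma finite_set_fm: "finite (set_fm \<phi>)"
  by (induction \<phi>) auto

lemma completeness:
  fixes \<phi> :: "'v::countable fm"
  assumes "valid TYPE('l::infinite) \<phi>"
  shows "\<turnstile> \<phi>"
proof (rule ccontr)
  assume "\<not> \<turnstile> \<phi>"
  obtain w where w: "world w" "w (Neg \<phi>)"
  \<comment> \<open>Here the property is consistency itself, and the unprovability of
    \<open>\<phi>\<close> makes \<open>Neg \<phi>\<close> consistent.\<close>
  proof (rule Lindenbaum[of "\<lambda>\<chi>. \<not> \<turnstile> Neg \<chi>" "Neg \<phi>"])
    show "\<not> \<turnstile> Neg b" if "\<turnstile> Imp a b" "\<not> \<turnstile> Neg a" for a b :: "'v fm"
    proof
      assume "\<turnstile> Neg b"
      with that(1) have "\<turnstile> Neg a" by (rule mp2[rotated]) (auto simp: tautology_def)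
      with that(2) show False ..
    qed
    show "\<not> \<turnstile> Neg a \<or> \<not> \<turnstile> Neg b" if "\<not> \<turnstile> Neg (Or a b)" for a b :: "'v fm"
    proof (rule ccontr)
      assume "\<not> (\<not> \<turnstile> Neg a \<or> \<not> \<turnstile> Neg b)"
      then have "\<turnstile> Neg a" "\<turnstile> Neg b" by blast+
      then have "\<turnstile> Neg (Or a b)" by (rule mp2[rotated]) (auto simp: tautology_def)
      with that show False ..
    qed
    have "\<turnstile> Top" by (rule mp1[OF _ eq_refl[of some_var]]) (auto simp: tautology_def)
    then show "\<not> \<not> \<turnstile> Top" by blast
    show "\<not> \<turnstile> Neg (Neg \<phi>)"
    proof
      assume "\<turnstile> Neg (Neg \<phi>)"
      then have "\<turnstile> \<phi>" by (rule mp1[rotated]) (auto simp: tautology_def)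
      with \<open>\<not> \<turnstile> \<phi>\<close> show False ..
    qed
  qed
  \<comment> \<open>The successor makes \<open>k\<close> positive even if there were no variables,
    as \<open>agree_sat\<close> demands.\<close>
  define k where "k = Suc (card (set_fm \<phi>))"
  have "card (set_fm \<phi>) \<le> size_bound k \<phi>"
    using size_bound_ge[of k \<phi>] unfolding k_def by simp
  then obtain s :: "('v, 'l) store" and h where ag: "agree (set_fm \<phi>) (size_bound k \<phi>) w s h"
    using agree_realizable[OF w(1) finite_set_fm] by blast
  have "w \<phi> \<longleftrightarrow> sat s h \<phi>"
    by (rule agree_sat[OF finite_set_fm _ _ subset_refl ag order_refl]) (simp_all add: k_def)
  moreover have "sat s h \<phi>" using assms agreeD(2)[OF ag] unfolding valid_def by blast
  ultimately show False using w world_Neg[OF w(1)] by blast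
qed

theorem theorem3p4:
  fixes \<phi> :: "'v::{countable,infinite} fm"
  shows "valid TYPE('l::{countable,infinite}) \<phi> \<longleftrightarrow> \<turnstile> \<phi>"
  using completeness soundness unfolding valid_def by blast

end
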